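(* Let $D$ be a $2$-dimensional regular local ring with maximal ideal $\mathfrak{m}_D=(x,y)D$ and with an algebraically closed coefficient field $k$. Let $$A=D\Big[\Big\{\tfrac{y^2}{x+ay}: a\in k\Big\}\cup\Big\{\tfrac{x^2}{y}\Big\}\Big],\quad \mathfrak{m}=\Big(x,y,\Big\{\tfrac{y^2}{x+ay}: a\in k\Big\}\cup\Big\{\tfrac{x^2}{y}\Big\}\Big)A,\quad C=A_{\mathfrak{m}}.$$ For $a\in k$ let $\alpha_a=D[\frac{x+ay}{y}]_{(y,\frac{x+ay}{y})}$, $\beta_a=\alpha_a[\frac{y^2}{x+ay}]_{(\frac{x+ay}{y},\frac{y^2}{x+ay})}$, and let $\alpha'=D[\frac{y}{x}]_{(x,\frac{y}{x})}$, $\beta'=\alpha'[\frac{x^2}{y}]_{(\frac{y}{x},\frac{x^2}{y})}$ (localizations at the ideals generated by the indicated elements). Then $C=\bigcap_{a\in k}\beta_a\cap\beta'$, and $C$ is a non-Noetherian local domain which is an intersection of rings in $Q(D)$.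
   Context: A coefficient field of $D$ is a subfield $k\subseteq D$ mapping isomorphically onto $D/\mathfrak{m}_D$. $Q(D)$ denotes the set of all $2$-dimensional regular local rings $\alpha$ with $D\subseteq\alpha\subseteq F$, where $F$ is the quotient field of $D$. *)

theory Defs
  imports "HOL-Computational_Algebra.Polynomial"
begin

text \<open>All rings are subrings of an ambient field, the type 'a :: field,
which plays the role of the quotient field F of D.\<close>

definition subring :: "'a::field set \<Rightarrow> bool" where
  "subring R \<longleftrightarrow> 0 \<in> R \<and> 1 \<in> R \<and>
     (\<forall>a\<in>R. \<forall>b\<in>R. a + b \<in> R \<and> a - b \<in> R \<and> a * b \<in> R)"

definition subfield :: "'a::field set \<Rightarrow> bool" where
  "subfield K \<longleftrightarrow> subring K \<and> (\<forall>a\<in>K. a \<noteq> 0 \<longrightarrow> inverse a \<in> K)"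

definition ideal_in :: "'a::field set \<Rightarrow> 'a set \<Rightarrow> bool" where
  "ideal_in R I \<longleftrightarrow> I \<subseteq> R \<and> 0 \<in> I \<and> (\<forall>a\<in>I. \<forall>b\<in>I. a + b \<in> I) \<and>
     (\<forall>r\<in>R. \<forall>a\<in>I. r * a \<in> I)"

definition ideal_gen :: "'a::field set \<Rightarrow> 'a set \<Rightarrow> 'a set" where
  "ideal_gen R S = \<Inter> {I. ideal_in R I \<and> S \<subseteq> I}"

definition prime_in :: "'a::field set \<Rightarrow> 'a set \<Rightarrow> bool" where
  "prime_in R P \<longleftrightarrow> ideal_in R P \<and> P \<noteq> R \<and>
     (\<forall>a\<in>R. \<forall>b\<in>R. a * b \<in> P \<longrightarrow> a \<in> P \<or> b \<in> P)"

definition maximal_in :: "'a::field set \<Rightarrow> 'a set \<Rightarrow> bool" where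
  "maximal_in R M \<longleftrightarrow> ideal_in R M \<and> M \<noteq> R \<and>
     (\<forall>J. ideal_in R J \<and> M \<subseteq> J \<longrightarrow> J = M \<or> J = R)"

definition local_ring :: "'a::field set \<Rightarrow> bool" where
  "local_ring R \<longleftrightarrow> subring R \<and> (\<exists>!M. maximal_in R M)"

definition max_ideal :: "'a::field set \<Rightarrow> 'a set" where
  "max_ideal R = (THE M. maximal_in R M)"

definition noetherian :: "'a::field set \<Rightarrow> bool" where
  "noetherian R \<longleftrightarrow> subring R \<and>
     (\<forall>I. ideal_in R I \<longrightarrow> (\<exists>S. finite S \<and> S \<subseteq> R \<and> I = ideal_gen R S))"

definition prime_chain :: "'a::field set \<Rightarrow> nat \<Rightarrow> bool" where
  "prime_chain R n \<longleftrightarrow> (\<exists>P :: nat \<Rightarrow> 'a set.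
     (\<forall>i\<le>n. prime_in R (P i)) \<and> (\<forall>i<n. P i \<subset> P (Suc i)))"

definition krull_dim_eq :: "'a::field set \<Rightarrow> nat \<Rightarrow> bool" where
  "krull_dim_eq R n \<longleftrightarrow> prime_chain R n \<and> \<not> prime_chain R (Suc n)"

definition regular_local2 :: "'a::field set \<Rightarrow> bool" where
  "regular_local2 R \<longleftrightarrow> local_ring R \<and> noetherian R \<and> krull_dim_eq R 2 \<and>
     (\<exists>u\<in>R. \<exists>v\<in>R. max_ideal R = ideal_gen R {u, v})"

definition quotient_field_is_univ :: "'a::field set \<Rightarrow> bool" where
  "quotient_field_is_univ D \<longleftrightarrow> (\<forall>z. \<exists>a\<in>D. \<exists>b\<in>D. b \<noteq> 0 \<and> z = a / b)"

text \<open>k is a subfield of D mapping isomorphically onto D / m.\<close>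
definition coefficient_field :: "'a::field set \<Rightarrow> 'a set \<Rightarrow> bool" where
  "coefficient_field D k \<longleftrightarrow> subfield k \<and> k \<subseteq> D \<and>
     (\<forall>d\<in>D. \<exists>!c\<in>k. d - c \<in> max_ideal D)"

definition alg_closed_subfield :: "'a::field set \<Rightarrow> bool" where
  "alg_closed_subfield k \<longleftrightarrow> subfield k \<and>
     (\<forall>p :: 'a poly. (\<forall>i. coeff p i \<in> k) \<and> degree p > 0 \<longrightarrow> (\<exists>c\<in>k. poly p c = 0))"

definition adjoin :: "'a::field set \<Rightarrow> 'a set \<Rightarrow> 'a set" where
  "adjoin R S = \<Inter> {T. subring T \<and> R \<union> S \<subseteq> T}"

definition localize :: "'a::field set \<Rightarrow> 'a set \<Rightarrow> 'a set" where
  "localize R P = {r / s | r s. r \<in> R \<and> s \<in> R \<and> s \<notin> P}"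

definition Qset :: "'a::field set \<Rightarrow> 'a set set" where
  "Qset D = {\<alpha>. D \<subseteq> \<alpha> \<and> regular_local2 \<alpha>}"

end

theory Submission
  imports Defs
begin

text \<open>
  Write t = x / y. Each ring of the intersection belongs to a point of the projective line over k
  and arises from D by two quadratic transforms with parameters (u, v), namely (x + a y, y) or
  (y, x). It is again two-dimensional regular, with parameters u / v and v^2 / u, and it dominates A
  localized at m, because the generators of m are multiples of v^2 / u.

  Let f lie in the intersection. The denominators of f in D form a principal ideal q D, and q is a
  unit times a monomial in u / v and v^2 / u in each of the rings. Let g = y^e Q(t) be the initial
  form of q. Comparing orders along the two exceptional curves shows that q / g is a unit
  everywhere, so q / g and q f / g lie in the intersection as well. An element h / g of the
  intersection with h in D belongs to A: modulo higher order, h is a form y^j P(t), and membership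
  in the rings says that j = e + r with r nonnegative and that P / Q has poles of order at most r at
  the points of k and at most 2 r at infinity. By partial fractions y^r P(t) / Q(t) is then a
  polynomial in y, y t, y t^2 and the y / (t + a), all of which lie in A; if h has order at least
  2 e, the bounds on the poles are automatic. Hence f = (q f / g) / (q / g) lies in C.

  In the ring attached to a point, v divides the generator v^2 / u of every other point, but not its
  own. So the elements divisible by v there form infinitely many independent ideals of C, which
  therefore is not Noetherian.
\<close>

section \<open>Subrings and ideals of a field\<close>

lemma subring_zero: "subring R \<Longrightarrow> 0 \<in> R"
  and subring_one: "subring R \<Longrightarrow> 1 \<in> R"
  and subring_add: "subring R \<Longrightarrow> a \<in> R \<Longrightarrow> b \<in> R \<Longrightarrow> a + b \<in> R"
  and subring_diff: "subring R \<Longrightarrow> a \<in> R \<Longrightarrow> b \<in> R \<Longrightarrow> a - b \<in> R"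
  and subring_mult: "subring R \<Longrightarrow> a \<in> R \<Longrightarrow> b \<in> R \<Longrightarrow> a * b \<in> R"
  by (auto simp: subring_def)

lemma subring_uminus: "subring R \<Longrightarrow> a \<in> R \<Longrightarrow> - a \<in> R"
  using subring_diff[of R 0 a] subring_zero[of R] by simp

lemma subring_power: "subring R \<Longrightarrow> a \<in> R \<Longrightarrow> a ^ n \<in> R"
  by (induction n) (auto intro: subring_one subring_mult)

lemma subring_sum: "subring R \<Longrightarrow> (\<And>i. i \<in> I \<Longrightarrow> f i \<in> R) \<Longrightarrow> sum f I \<in> R"
  by (induction I rule: infinite_finite_induct) (auto intro: subring_zero subring_add)

lemmas subring_closed =
  subring_zero subring_one subring_add subring_diff subring_mult subring_uminus subring_power

lemma subring_INT: "(\<And>i. i \<in> I \<Longrightarrow> subring (R i)) \<Longrightarrow> subring (\<Inter>i\<in>I. R i)"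
  by (auto simp: subring_def)

definition units :: "'a::field set \<Rightarrow> 'a set" where
  "units R = {e \<in> R. e \<noteq> 0 \<and> inverse e \<in> R}"

lemma unitsI: "e \<in> R \<Longrightarrow> e \<noteq> 0 \<Longrightarrow> inverse e \<in> R \<Longrightarrow> e \<in> units R"
  and units_mem: "e \<in> units R \<Longrightarrow> e \<in> R"
  and units_nonzero: "e \<in> units R \<Longrightarrow> e \<noteq> 0"
  and units_inverse_mem: "e \<in> units R \<Longrightarrow> inverse e \<in> R"
  and units_inverse: "e \<in> units R \<Longrightarrow> inverse e \<in> units R"
  by (auto simp: units_def)

lemma units_one: "subring R \<Longrightarrow> 1 \<in> units R"
  by (simp add: units_def subring_one)

lemma units_mult: "subring R \<Longrightarrow> d \<in> units R \<Longrightarrow> e \<in> units R \<Longrightarrow> d * e \<in> units R"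
  by (auto simp: units_def intro: subring_mult)

lemma units_divide: "subring R \<Longrightarrow> d \<in> units R \<Longrightarrow> e \<in> units R \<Longrightarrow> d / e \<in> units R"
  by (simp add: divide_inverse units_mult units_inverse)

lemma units_of_mult_eq:
  assumes "subring R" "a \<in> R" "b \<in> R" "e \<in> units R" "a * b = e"
  shows "a \<in> units R"
proof (rule unitsI)
  have e: "e \<noteq> 0" using assms(4) by (rule units_nonzero)
  then show "a \<noteq> 0" using assms(5) by auto
  then have "inverse a = b * inverse e" using e assms(5) by (auto simp: field_simps)
  then show "inverse a \<in> R"
    using assms by (auto intro: subring_mult units_inverse_mem)
qed fact

lemma units_mono: "R \<subseteq> T \<Longrightarrow> units R \<subseteq> units T"
  by (auto simp: units_def)

lemma units_subfield: "subfield k \<Longrightarrow> units k = k - {0}"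
  by (auto simp: units_def subfield_def)

lemma ideal_inI:
  assumes "I \<subseteq> R" "0 \<in> I" "\<And>a b. a \<in> I \<Longrightarrow> b \<in> I \<Longrightarrow> a + b \<in> I"
    "\<And>r a. r \<in> R \<Longrightarrow> a \<in> I \<Longrightarrow> r * a \<in> I"
  shows "ideal_in R I"
  using assms by (auto simp: ideal_in_def)

lemma ideal_in_subset: "ideal_in R I \<Longrightarrow> I \<subseteq> R"
  and ideal_in_mem: "ideal_in R I \<Longrightarrow> a \<in> I \<Longrightarrow> a \<in> R"
  and ideal_in_0: "ideal_in R I \<Longrightarrow> 0 \<in> I"
  and ideal_in_add: "ideal_in R I \<Longrightarrow> a \<in> I \<Longrightarrow> b \<in> I \<Longrightarrow> a + b \<in> I"
  and ideal_in_mult_left: "ideal_in R I \<Longrightarrow> r \<in> R \<Longrightarrow> a \<in> I \<Longrightarrow> r * a \<in> I"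
  and ideal_in_mult_right: "ideal_in R I \<Longrightarrow> r \<in> R \<Longrightarrow> a \<in> I \<Longrightarrow> a * r \<in> I"
  by (auto simp: ideal_in_def mult.commute)

lemma ideal_in_diff:
  assumes "subring R" "ideal_in R I" "a \<in> I" "b \<in> I"
  shows "a - b \<in> I"
  using ideal_in_add[OF assms(2,3) ideal_in_mult_left[OF assms(2) _ assms(4), of "- 1"]] assms(1)
  by (simp add: subring_closed)

lemma ideal_in_self: "subring R \<Longrightarrow> ideal_in R R"
  and ideal_in_zero_ideal: "subring R \<Longrightarrow> ideal_in R {0}"
  by (auto simp: ideal_in_def intro: subring_closed)

lemma ideal_in_eq_ring: "ideal_in R I \<Longrightarrow> 1 \<in> I \<Longrightarrow> I = R"
  using ideal_in_mult_left[of R I _ 1] by (auto dest: ideal_in_mem)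

lemma ideal_in_eq_ring_if_unit:
  assumes "ideal_in R I" "e \<in> I" "e \<in> units R"
  shows "I = R"
  using ideal_in_mult_left[OF assms(1) units_inverse_mem[OF assms(3)] assms(2)]
    units_nonzero[OF assms(3)] ideal_in_eq_ring[OF assms(1)] by simp

lemma ideal_in_INT:
  "subring R \<Longrightarrow> (\<And>i. i \<in> X \<Longrightarrow> ideal_in R (I i)) \<Longrightarrow> ideal_in R (R \<inter> (\<Inter>i\<in>X. I i))"
  by (auto simp: ideal_in_def intro: subring_closed)

lemma ideal_in_contraction:
  "subring R \<Longrightarrow> R \<subseteq> T \<Longrightarrow> ideal_in T J \<Longrightarrow> ideal_in R (R \<inter> J)"
  by (auto simp: ideal_in_def intro: subring_closed)

definition ideal_insert :: "'a::field set \<Rightarrow> 'a set \<Rightarrow> 'a \<Rightarrow> 'a set" where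
  "ideal_insert R I x = {a + r * x | a r. a \<in> I \<and> r \<in> R}"

lemma ideal_insertI: "a \<in> I \<Longrightarrow> r \<in> R \<Longrightarrow> s = a + r * x \<Longrightarrow> s \<in> ideal_insert R I x"
  by (auto simp: ideal_insert_def)

lemma ideal_insertE:
  assumes "s \<in> ideal_insert R I x" obtains a r where "a \<in> I" "r \<in> R" "s = a + r * x"
  using assms by (auto simp: ideal_insert_def)

lemma ideal_insert_superset: "subring R \<Longrightarrow> I \<subseteq> ideal_insert R I x"
  by (auto intro: ideal_insertI[of _ _ 0] subring_zero)

lemma ideal_insert_self: "subring R \<Longrightarrow> ideal_in R I \<Longrightarrow> x \<in> ideal_insert R I x"
  by (rule ideal_insertI[of 0 _ 1]) (auto intro: ideal_in_0 subring_one)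

lemma ideal_insert_least: "ideal_in R J \<Longrightarrow> I \<subseteq> J \<Longrightarrow> x \<in> J \<Longrightarrow> ideal_insert R I x \<subseteq> J"
  by (auto elim!: ideal_insertE intro!: ideal_in_add[of R J] ideal_in_mult_left[of R J])

lemma ideal_in_ideal_insert:
  assumes R: "subring R" and I: "ideal_in R I" and x: "x \<in> R"
  shows "ideal_in R (ideal_insert R I x)"
proof (rule ideal_inI)
  show "ideal_insert R I x \<subseteq> R"
    using ideal_in_self[OF R] ideal_in_subset[OF I] x by (rule ideal_insert_least)
  show "0 \<in> ideal_insert R I x"
    using ideal_in_0[OF I] ideal_insert_superset[OF R] by blast
next
  fix s t assume "s \<in> ideal_insert R I x" "t \<in> ideal_insert R I x"
  then obtain a b p q where mem: "a \<in> I" "b \<in> I" "p \<in> R" "q \<in> R" and "s = a + p * x" "t = b + q * x"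
    by (elim ideal_insertE) blast
  then have "s + t = (a + b) + (p + q) * x" by (simp add: algebra_simps)
  then show "s + t \<in> ideal_insert R I x"
    by (rule ideal_insertI[OF ideal_in_add[OF I mem(1,2)] subring_add[OF R mem(3,4)]])
next
  fix r s assume r: "r \<in> R" and "s \<in> ideal_insert R I x"
  then obtain a p where mem: "a \<in> I" "p \<in> R" and "s = a + p * x" by (elim ideal_insertE) blast
  then have "r * s = r * a + (r * p) * x" by (simp add: algebra_simps)
  then show "r * s \<in> ideal_insert R I x"
    by (rule ideal_insertI[OF ideal_in_mult_left[OF I r mem(1)] subring_mult[OF R r mem(2)]])
qed

lemma subring_plus_ideal:
  assumes A: "subring A" and k: "subring k" "k \<subseteq> A" and I: "ideal_in A I"
  shows "subring {c + t | c t. c \<in> k \<and> t \<in> I}" (is "subring ?U")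
  unfolding subring_def
proof (intro conjI ballI)
  have UI: "s \<in> ?U" if "c \<in> k" "t \<in> I" "s = c + t" for s c t using that by blast
  show "0 \<in> ?U" using k(1) ideal_in_0[OF I] by (intro UI[of 0 0]) (auto intro: subring_closed)
  show "1 \<in> ?U" using k(1) ideal_in_0[OF I] by (intro UI[of 1 0]) (auto intro: subring_closed)
  fix a b assume "a \<in> ?U" "b \<in> ?U"
  then obtain c d t w where parts: "a = c + t" "b = d + w" "c \<in> k" "d \<in> k" "t \<in> I" "w \<in> I" by blast
  show "a + b \<in> ?U"
    by (rule UI[of "c + d" "t + w"])
      (use parts k(1) ideal_in_add[OF I] in \<open>auto intro: subring_add\<close>)
  show "a - b \<in> ?U"
    by (rule UI[of "c - d" "t - w"])
      (use parts k(1) ideal_in_diff[OF A I] in \<open>auto intro: subring_diff\<close>)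
  show "a * b \<in> ?U"
  proof (rule UI[of "c * d" "c * w + b * t"])
    have "b \<in> A" using parts k(2) ideal_in_mem[OF I] by (auto intro: subring_add[OF A])
    then show "c * w + b * t \<in> I"
      using parts k(2) by (intro ideal_in_add[OF I] ideal_in_mult_left[OF I]) auto
    show "a * b = c * d + (c * w + b * t)" using parts(1,2) by (simp add: algebra_simps)
  qed (use parts k(1) in \<open>auto intro: subring_mult\<close>)
qed

lemma ideal_gen_superset: "S \<subseteq> ideal_gen R S"
  and ideal_gen_least: "ideal_in R I \<Longrightarrow> S \<subseteq> I \<Longrightarrow> ideal_gen R S \<subseteq> I"
  by (auto simp: ideal_gen_def)

lemma ideal_in_ideal_gen:
  assumes "subring R" "S \<subseteq> R"
  shows "ideal_in R (ideal_gen R S)"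
  using ideal_gen_least[OF ideal_in_self assms(2)] assms(1)
  by (auto simp: ideal_gen_def ideal_in_def)

definition multiples :: "'a::field set \<Rightarrow> 'a \<Rightarrow> 'a set" where
  "multiples R v = {a * v | a. a \<in> R}"

definition span2 :: "'a::field set \<Rightarrow> 'a \<Rightarrow> 'a \<Rightarrow> 'a set" where
  "span2 R u v = {a * u + b * v | a b. a \<in> R \<and> b \<in> R}"

lemma multiplesI: "a \<in> R \<Longrightarrow> r = a * v \<Longrightarrow> r \<in> multiples R v"
  by (auto simp: multiples_def)

lemma multiplesE: assumes "r \<in> multiples R v" obtains a where "a \<in> R" "r = a * v"
  using assms by (auto simp: multiples_def)

lemma span2I: "a \<in> R \<Longrightarrow> b \<in> R \<Longrightarrow> r = a * u + b * v \<Longrightarrow> r \<in> span2 R u v"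
  by (auto simp: span2_def)

lemma span2E: assumes "r \<in> span2 R u v" obtains a b where "a \<in> R" "b \<in> R" "r = a * u + b * v"
  using assms by (auto simp: span2_def)

lemma multiples_eq_ideal_insert: "multiples R v = ideal_insert R {0} v"
  by (simp add: multiples_def ideal_insert_def)

lemma span2_eq_ideal_insert: "span2 R u v = ideal_insert R (multiples R u) v"
  by (auto simp: span2_def multiples_def ideal_insert_def)

lemma ideal_in_multiples: "subring R \<Longrightarrow> v \<in> R \<Longrightarrow> ideal_in R (multiples R v)"
  by (simp add: multiples_eq_ideal_insert ideal_in_ideal_insert ideal_in_zero_ideal)

lemma ideal_in_span2: "subring R \<Longrightarrow> u \<in> R \<Longrightarrow> v \<in> R \<Longrightarrow> ideal_in R (span2 R u v)"
  by (simp add: span2_eq_ideal_insert ideal_in_ideal_insert ideal_in_multiples)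

lemma span2_commute: "span2 R u v = span2 R v u"
  unfolding span2_def by (auto simp: add.commute) (metis add.commute)+

lemma span2_left: "subring R \<Longrightarrow> u \<in> span2 R u v"
  and span2_right: "subring R \<Longrightarrow> v \<in> span2 R u v"
  by (rule span2I[of 1 R 0] span2I[of 0 R 1]; simp add: subring_closed)+

lemma span2_least: "ideal_in R I \<Longrightarrow> u \<in> I \<Longrightarrow> v \<in> I \<Longrightarrow> span2 R u v \<subseteq> I"
  by (auto elim!: span2E intro: ideal_in_add ideal_in_mult_left)

lemma span2_shear:
  assumes R: "subring R" and "a \<in> R"
  shows "span2 R (u + a * v) v = span2 R u v"
proof (intro equalityI subsetI)
  fix r assume "r \<in> span2 R (u + a * v) v"
  then obtain b c where "b \<in> R" "c \<in> R" "r = b * (u + a * v) + c * v" by (rule span2E)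
  then show "r \<in> span2 R u v"
    using assms
    by (intro span2I[of b R "b * a + c"]) (auto simp: algebra_simps intro: subring_closed)
next
  fix r assume "r \<in> span2 R u v"
  then obtain b c where "b \<in> R" "c \<in> R" "r = b * u + c * v" by (rule span2E)
  then show "r \<in> span2 R (u + a * v) v"
    using assms
    by (intro span2I[of b R "c - b * a"]) (auto simp: algebra_simps intro: subring_closed)
qed

lemma ideal_gen_pair:
  assumes "subring R" "u \<in> R" "v \<in> R"
  shows "ideal_gen R {u, v} = span2 R u v"
proof
  show "ideal_gen R {u, v} \<subseteq> span2 R u v"
    using assms by (intro ideal_gen_least ideal_in_span2) (auto intro: span2_left span2_right)
  show "span2 R u v \<subseteq> ideal_gen R {u, v}"
    using assms ideal_gen_superset[of "{u, v}" R] by (intro span2_least ideal_in_ideal_gen) auto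
qed

lemma multiples_self: "subring R \<Longrightarrow> v \<in> multiples R v"
  by (simp add: multiplesI[of 1] subring_one)

lemma multiples_least: "ideal_in R I \<Longrightarrow> v \<in> I \<Longrightarrow> multiples R v \<subseteq> I"
  by (auto elim!: multiplesE intro: ideal_in_mult_left)

lemma prime_in_ideal: "prime_in R P \<Longrightarrow> ideal_in R P"
  and prime_in_mult: "prime_in R P \<Longrightarrow> a \<in> R \<Longrightarrow> b \<in> R \<Longrightarrow> a * b \<in> P \<Longrightarrow> a \<in> P \<or> b \<in> P"
  by (auto simp: prime_in_def)

lemma prime_in_one: "prime_in R P \<Longrightarrow> 1 \<notin> P"
  using ideal_in_eq_ring by (auto simp: prime_in_def)

lemma prime_inI:
  assumes "subring R" "ideal_in R P" "1 \<notin> P"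
    "\<And>a b. a \<in> R \<Longrightarrow> b \<in> R \<Longrightarrow> a * b \<in> P \<Longrightarrow> a \<in> P \<or> b \<in> P"
  shows "prime_in R P"
  using assms subring_one by (auto simp: prime_in_def)

lemma prime_in_unit: "prime_in R P \<Longrightarrow> e \<in> units R \<Longrightarrow> e \<notin> P"
  using ideal_in_eq_ring_if_unit by (auto simp: prime_in_def)

lemma prime_in_zero: "subring R \<Longrightarrow> prime_in R {0}"
  by (intro prime_inI ideal_in_zero_ideal) auto

lemma prime_in_power:
  assumes "subring R" "prime_in R P" "a \<in> R" "a ^ n \<in> P"
  shows "a \<in> P"
  using assms(4)
proof (induction n)
  case 0
  then show ?case using prime_in_one[OF assms(2)] by simp
next
  case (Suc n)
  then show ?case
    using prime_in_mult[OF assms(2,3), of "a ^ n"] assms by (auto intro: subring_power)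
qed

lemma prime_power_factors:
  assumes R: "subring R" and t: "t \<noteq> 0" "prime_in R (multiples R t)"
    and "a \<in> R" "b \<in> R" "c \<in> R" "a * b = t ^ n * c"
  obtains i j a' b' where "a' \<in> R" "b' \<in> R" "a = t ^ i * a'" "b = t ^ j * b'" "a' * b' = c"
  using assms(4,5,7)
proof (induction n arbitrary: a b thesis)
  case 0
  show ?case by (rule 0(1)[of a b 0 0]) (use 0(2-) in simp_all)
next
  case (Suc n)
  note ab = Suc.prems(2-4)
  have tR: "t \<in> R" using ideal_in_mem[OF prime_in_ideal[OF t(2)] multiples_self[OF R]] .
  have "a * b \<in> multiples R t"
    using R tR \<open>c \<in> R\<close> ab(3)
    by (intro multiplesI[of "t ^ n * c"]) (auto intro: subring_closed simp: ac_simps)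
  then consider a' where "a' \<in> R" "a = a' * t" | b' where "b' \<in> R" "b = b' * t"
    using prime_in_mult[OF t(2) ab(1,2)] by (blast elim: multiplesE)
  then show ?case
  proof cases
    case 1
    then have "a' * b = t ^ n * c" using ab(3) t(1) by (simp add: ac_simps)
    then obtain i j a'' b'
      where "a'' \<in> R" "b' \<in> R" "a' = t ^ i * a''" "b = t ^ j * b'" "a'' * b' = c"
      using Suc.IH[of a' b] 1(1) ab(2) by blast
    then show ?thesis
      using 1 by (intro Suc.prems(1)[of a'' b' "Suc i" j]) (simp_all add: ac_simps)
  next
    case 2
    then have "a * b' = t ^ n * c" using ab(3) t(1) by (simp add: ac_simps)
    then obtain i j a' b''
      where "a' \<in> R" "b'' \<in> R" "a = t ^ i * a'" "b' = t ^ j * b''" "a' * b'' = c"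
      using Suc.IH[of a b'] 2(1) ab(1) by blast
    then show ?thesis
      using 2 by (intro Suc.prems(1)[of a' b'' i "Suc j"]) (simp_all add: ac_simps)
  qed
qed

section \<open>Noetherian rings\<close>

lemma noetherian_subring: "noetherian R \<Longrightarrow> subring R"
  by (simp add: noetherian_def)

lemma ideal_in_Union_chain:
  assumes chain: "\<C> \<noteq> {}" "subset.chain \<F> \<C>" and ideals: "\<And>I. I \<in> \<F> \<Longrightarrow> ideal_in R I"
  shows "ideal_in R (\<Union>\<C>)"
proof (rule ideal_inI)
  have mem: "ideal_in R I" if "I \<in> \<C>" for I
    using chain(2) ideals that by (auto simp: subset.chain_def)
  then show "\<Union>\<C> \<subseteq> R" "0 \<in> \<Union>\<C>"
    using chain(1) by (auto dest: ideal_in_mem ideal_in_0)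
  show "r * a \<in> \<Union>\<C>" if "r \<in> R" "a \<in> \<Union>\<C>" for r a
    using that mem ideal_in_mult_left by blast
  fix a b assume "a \<in> \<Union>\<C>" "b \<in> \<Union>\<C>"
  then obtain I where I: "I \<in> \<C>" "{a, b} \<subseteq> I"
    using finite_subset_Union_chain[of "{a, b}" \<C> \<F>] chain by auto
  then show "a + b \<in> \<Union>\<C>" using ideal_in_add[OF mem[OF I(1)], of a b] by auto
qed

lemma noetherian_maximal:
  assumes R: "noetherian R" and "\<F> \<noteq> {}" and ideals: "\<And>I. I \<in> \<F> \<Longrightarrow> ideal_in R I"
  shows "\<exists>M\<in>\<F>. \<forall>J\<in>\<F>. M \<subseteq> J \<longrightarrow> J = M"
proof (rule subset_Zorn_nonempty[OF \<open>\<F> \<noteq> {}\<close>])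
  fix \<C> assume chain: "\<C> \<noteq> {}" "subset.chain \<F> \<C>"
  then have "ideal_in R (\<Union>\<C>)" using ideals by (rule ideal_in_Union_chain)
  then obtain S where S: "finite S" "\<Union>\<C> = ideal_gen R S"
    using R unfolding noetherian_def by blast
  then obtain I where I: "I \<in> \<C>" "S \<subseteq> I"
    using finite_subset_Union_chain[OF S(1) _ chain] ideal_gen_superset by blast
  then have "I \<in> \<F>" using chain(2) by (auto simp: subset.chain_def)
  moreover from this have "\<Union>\<C> \<subseteq> I" unfolding S(2) using ideals I(2) by (intro ideal_gen_least)
  ultimately show "\<Union>\<C> \<in> \<F>" using I(1) by (metis Union_upper subset_antisym)
qed

lemma noetherian_stable:
  fixes I :: "nat \<Rightarrow> 'a::field set"
  assumes R: "noetherian R" and I: "\<And>n. ideal_in R (I n)" and mono: "\<And>n. I n \<subseteq> I (Suc n)"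
  shows "\<exists>N. \<forall>n\<ge>N. I n = I N"
proof -
  obtain N where "\<forall>n. I N \<subseteq> I n \<longrightarrow> I n = I N"
    using noetherian_maximal[OF R, of "range I"] I by auto
  then show ?thesis using mono by (meson lift_Suc_mono_le)
qed

text \<open>For \<^term>\<open>N = {0}\<close> this is Krull's intersection theorem for a principal ideal, for
  \<^term>\<open>X\<close> an ideal it is Nakayama's lemma.\<close>

lemma noetherian_descent:
  assumes R: "noetherian R" and N: "ideal_in R N" and w: "w \<in> R"
    and unit: "\<And>r. r \<in> R \<Longrightarrow> 1 - r * w \<in> units R"
    and X: "X \<subseteq> R" and step: "\<And>x. x \<in> X \<Longrightarrow> \<exists>x'\<in>X. x - w * x' \<in> N"
  shows "X \<subseteq> N"
proof (rule ccontr)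
  assume "\<not> X \<subseteq> N"
  note subring = noetherian_subring[OF R]
  define I where "I = ideal_insert R N"
  have ideal: "ideal_in R (I x)" if "x \<in> X" for x
    unfolding I_def using subring N that X by (intro ideal_in_ideal_insert) auto
  have "\<exists>M\<in>I ` (X - N). \<forall>J\<in>I ` (X - N). M \<subseteq> J \<longrightarrow> J = M"
    using ideal \<open>\<not> X \<subseteq> N\<close> by (intro noetherian_maximal[OF R]) auto
  then have "\<exists>x\<in>X - N. \<forall>x'\<in>X - N. I x \<subseteq> I x' \<longrightarrow> I x' = I x"
    unfolding ball_simps bex_simps .
  then obtain x where x: "x \<in> X" "x \<notin> N"
    and maximal: "\<forall>x'\<in>X - N. I x \<subseteq> I x' \<longrightarrow> I x' = I x"
    by blast
  obtain x' where x': "x' \<in> X" "x - w * x' \<in> N" using step x(1) by blast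
  then have "x' \<notin> N"
    using x(2) ideal_in_add[OF N x'(2) ideal_in_mult_left[OF N w, of x']] by auto
  moreover have "x \<in> I x'" unfolding I_def using x'(2) w by (rule ideal_insertI) simp
  then have "I x \<subseteq> I x'"
    using ideal_insert_least[OF ideal[OF x'(1)]] ideal_insert_superset[OF subring]
    by (simp add: I_def)
  ultimately have "I x' = I x" using maximal x'(1) by simp
  then have "x' \<in> I x" using ideal_insert_self[OF subring N, of x'] by (simp add: I_def)
  then obtain a r where ar: "a \<in> N" "r \<in> R" "x' = a + r * x" unfolding I_def by (rule ideal_insertE)
  have "(1 - r * w) * x' = a + r * (x - w * x')" using ar(3) by (simp add: algebra_simps)
  also have "\<dots> \<in> N" by (rule ideal_in_add[OF N ar(1) ideal_in_mult_left[OF N ar(2) x'(2)]])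
  finally have "(1 - r * w) * x' \<in> N" .
  then have "inverse (1 - r * w) * ((1 - r * w) * x') \<in> N"
    by (rule ideal_in_mult_left[OF N units_inverse_mem[OF unit[OF ar(2)]]])
  then show False
    using \<open>x' \<notin> N\<close> units_nonzero[OF unit[OF ar(2)]] by (simp add: mult.assoc[symmetric])
qed

lemma noetherian_ex_maximal_in:
  assumes R: "noetherian R" and I: "ideal_in R I" "I \<noteq> R"
  shows "\<exists>M. maximal_in R M \<and> I \<subseteq> M"
proof -
  define \<F> where "\<F> = {J. ideal_in R J \<and> J \<noteq> R \<and> I \<subseteq> J}"
  have "\<exists>M\<in>\<F>. \<forall>J\<in>\<F>. M \<subseteq> J \<longrightarrow> J = M"
    using I by (intro noetherian_maximal[OF R]) (auto simp: \<F>_def)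
  then obtain M where M: "M \<in> \<F>" and maximal: "\<And>J. J \<in> \<F> \<Longrightarrow> M \<subseteq> J \<Longrightarrow> J = M" by blast
  have "J = M \<or> J = R" if "ideal_in R J" "M \<subseteq> J" for J
    using M maximal[of J] that by (auto simp: \<F>_def)
  then show ?thesis
    using M by (intro exI[of _ M]) (simp add: maximal_in_def \<F>_def)
qed

lemma not_noetherian_of_independent_ideals:
  assumes R: "subring R" and inf: "infinite K"
    and N: "\<And>i. i \<in> K \<Longrightarrow> ideal_in R (N i)"
    and c: "\<And>i. i \<in> K \<Longrightarrow> c i \<in> R \<and> c i \<notin> N i"
      "\<And>i j. i \<in> K \<Longrightarrow> j \<in> K \<Longrightarrow> i \<noteq> j \<Longrightarrow> c i \<in> N j"
  shows "\<not> noetherian R"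
proof
  assume noeth: "noetherian R"
  define J where "J F = R \<inter> (\<Inter>i\<in>K - F. N i)" for F
  have "ideal_in R (J F)" for F
    unfolding J_def using R N by (intro ideal_in_INT) auto
  then obtain F where F: "finite F" "\<And>F'. finite F' \<Longrightarrow> J F \<subseteq> J F' \<Longrightarrow> J F' = J F"
    using noetherian_maximal[OF noeth, of "J ` {F. finite F}"] by auto
  obtain i where i: "i \<in> K" "i \<notin> F" using inf F(1) by (meson finite_subset subsetI)
  have "J (insert i F) = J F" using F(1) by (intro F(2)) (auto simp: J_def)
  moreover have "c i \<in> J (insert i F)" using c(1)[OF i(1)] c(2)[OF i(1)] by (auto simp: J_def)
  moreover have "c i \<notin> J F" using c(1)[OF i(1)] i by (auto simp: J_def)
  ultimately show False by simp
qed

section \<open>Local rings\<close>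

locale local_subring =
  fixes R M :: "'a::field set"
  assumes subring: "subring R"
    and ideal: "ideal_in R M"
    and proper: "1 \<notin> M"
    and unit: "\<And>r. r \<in> R \<Longrightarrow> r \<notin> M \<Longrightarrow> inverse r \<in> R"
begin

lemmas closed = subring_closed[OF subring]
  and unit_mem = units_mem[of _ R]
  and inverse_unit_mem = units_inverse_mem[of _ R]

lemma units_eq: "units R = R - M"
proof (intro equalityI subsetI)
  fix e assume "e \<in> units R"
  moreover have "e \<notin> M"
    using ideal_in_eq_ring_if_unit[OF ideal _ \<open>e \<in> units R\<close>] proper closed(2) by blast
  ultimately show "e \<in> R - M" by (simp add: units_mem)
next
  fix r assume "r \<in> R - M"
  then show "r \<in> units R" using unit ideal_in_0[OF ideal] by (auto intro: unitsI)
qed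

lemma proper_ideal_subset:
  assumes "ideal_in R J" "J \<noteq> R"
  shows "J \<subseteq> M"
  using assms ideal_in_eq_ring_if_unit[OF assms(1)] ideal_in_subset[OF assms(1)] units_eq by auto

lemma one_minus_unit: "m \<in> M \<Longrightarrow> 1 - m \<in> units R"
  using ideal_in_add[OF ideal, of "1 - m" m] proper closed ideal_in_mem[OF ideal]
  by (auto simp: units_eq)

lemma maximal_in_iff: "maximal_in R N \<longleftrightarrow> N = M"
proof -
  have "M \<noteq> R" using proper closed(2) by auto
  then show ?thesis unfolding maximal_in_def using proper_ideal_subset ideal by blast
qed

lemma local_ring: "local_ring R"
  and max_ideal: "max_ideal R = M"
  using subring maximal_in_iff by (auto simp: local_ring_def max_ideal_def)

lemma prime_in_max: "prime_in R M"
proof (rule prime_inI[OF subring ideal proper], rule ccontr)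
  fix a b assume "a \<in> R" "b \<in> R" "a * b \<in> M" "\<not> (a \<in> M \<or> b \<in> M)"
  then show False using units_mult[OF subring, of a b] by (auto simp: units_eq)
qed

end

lemma noetherian_local_subring:
  assumes R: "noetherian R" "local_ring R"
  shows "local_subring R (max_ideal R)"
proof
  show subring: "subring R" using R(1) by (rule noetherian_subring)
  have ex1: "\<exists>!M. maximal_in R M" using R(2) by (simp add: local_ring_def)
  have maximal: "maximal_in R (max_ideal R)"
    unfolding max_ideal_def using ex1 by (rule theI')
  then show "ideal_in R (max_ideal R)" "1 \<notin> max_ideal R"
    using ideal_in_eq_ring by (auto simp: maximal_in_def)
  fix r assume r: "r \<in> R" "r \<notin> max_ideal R"
  have "multiples R r = R"
  proof (rule ccontr)
    assume "multiples R r \<noteq> R"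
    then obtain N where "maximal_in R N" "multiples R r \<subseteq> N"
      using noetherian_ex_maximal_in[OF R(1) ideal_in_multiples[OF subring r(1)]] by blast
    moreover from this have "N = max_ideal R" using ex1 maximal by blast
    ultimately show False using multiples_self[OF subring] r(2) by blast
  qed
  then have "1 \<in> multiples R r" using subring_one[OF subring] by simp
  then obtain a where "a \<in> R" "1 = a * r" by (rule multiplesE)
  then show "inverse r \<in> R" by (metis inverse_unique mult.commute)
qed

section \<open>Noetherian local rings with a two-generated maximal ideal\<close>

locale two_gen_local = local_subring R "span2 R u v" for R :: "'a::field set" and u v +
  assumes noeth: "noetherian R"
    and u: "u \<in> R" and v: "v \<in> R"
begin

lemma u_in_max: "u \<in> span2 R u v" and v_in_max: "v \<in> span2 R u v"
  using subring by (rule span2_left span2_right)+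

lemma ideal_v: "ideal_in R (multiples R v)"
  using subring v by (rule ideal_in_multiples)

lemma descent:
  assumes "ideal_in R N" "w \<in> span2 R u v" "X \<subseteq> R"
    and "\<And>x. x \<in> X \<Longrightarrow> \<exists>x'\<in>X. x - w * x' \<in> N"
  shows "X \<subseteq> N"
proof (rule noetherian_descent[OF noeth assms(1) _ _ assms(3,4)])
  show "1 - r * w \<in> units R" if "r \<in> R" for r
    using that assms(2) by (intro one_minus_unit ideal_in_mult_left[OF ideal])
qed (use assms(2) ideal_in_mem[OF ideal] in auto)

lemma u_power_expansion:
  assumes "r \<in> R" "r \<notin> multiples R v"
  shows "\<exists>n. \<exists>e\<in>units R. \<exists>h\<in>R. r = e * u ^ n + h * v"
proof (rule ccontr)
  assume no: "\<not> ?thesis"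
  define X where "X = {r\<in>R. \<nexists>n. \<exists>e\<in>units R. \<exists>h\<in>R. r = e * u ^ n + h * v}"
  have "X \<subseteq> multiples R v"
  proof (rule descent[OF ideal_v u_in_max])
    fix r assume r: "r \<in> X"
    have "r \<notin> units R"
    proof
      assume "r \<in> units R"
      moreover have "r = r * u ^ 0 + 0 * v" by simp
      ultimately show False using r closed(1) unfolding X_def by blast
    qed
    then have "r \<in> span2 R u v" using r units_eq by (auto simp: X_def)
    then obtain a b where ab: "a \<in> R" "b \<in> R" "r = a * u + b * v" by (rule span2E)
    have "a \<in> X"
    proof (rule ccontr)
      assume "a \<notin> X"
      then obtain n e h where "e \<in> units R" "h \<in> R" "a = e * u ^ n + h * v"
        using ab(1) unfolding X_def by blast
      moreover from this have "r = e * u ^ Suc n + (h * u + b) * v"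
        using ab(3) by (simp add: algebra_simps)
      moreover have "h * u + b \<in> R" using \<open>h \<in> R\<close> ab(2) u by (intro closed)
      ultimately show False using r unfolding X_def by blast
    qed
    then show "\<exists>x'\<in>X. r - u * x' \<in> multiples R v"
      using ab by (intro bexI[of _ a]) (auto simp: mult.commute intro: multiplesI)
  qed (auto simp: X_def)
  then show False using assms no by (auto simp: X_def)
qed

lemma max_ideal_expansion:
  assumes "r \<in> span2 R u v" "r \<notin> multiples R v"
  shows "\<exists>n>0. \<exists>e\<in>units R. \<exists>h\<in>R. r = e * u ^ n + h * v"
proof -
  obtain n e h where e: "e \<in> units R" "h \<in> R" "r = e * u ^ n + h * v"
    using u_power_expansion[OF ideal_in_mem[OF ideal assms(1)] assms(2)] by blast
  have "n > 0"
  proof (rule ccontr)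
    assume "\<not> n > 0"
    then have "e = r - h * v" using e(3) by simp
    also have "\<dots> \<in> span2 R u v"
      using assms(1) e(2) v_in_max
      by (intro ideal_in_diff[OF subring ideal] ideal_in_mult_left[OF ideal])
    finally show False using e(1) units_eq by blast
  qed
  then show ?thesis using e by blast
qed

text \<open>Modulo \<^term>\<open>v\<close> every element is zero or a unit times a power of \<^term>\<open>u\<close>, so divisibility
  is a linear order there.\<close>

lemma exists_divisor_mod_v:
  assumes X: "X \<subseteq> R" "\<not> X \<subseteq> multiples R v"
  obtains g where "g \<in> X" "g \<notin> multiples R v" "\<And>x. x \<in> X \<Longrightarrow> \<exists>c\<in>R. x - c * g \<in> multiples R v"
proof -
  define E where "E x n \<longleftrightarrow> x \<notin> multiples R v \<and> (\<exists>e\<in>units R. \<exists>h\<in>R. x = e * u ^ n + h * v)" for x n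
  define n where "n = (LEAST n. \<exists>x\<in>X. E x n)"
  have ex: "\<exists>n. E x n" if "x \<in> X" "x \<notin> multiples R v" for x
    using u_power_expansion[of x] that X(1) by (auto simp: E_def)
  then have "\<exists>n. \<exists>x\<in>X. E x n" using X by blast
  then have "\<exists>x\<in>X. E x n" unfolding n_def by (rule LeastI_ex)
  then obtain g e h
    where g: "g \<in> X" "g \<notin> multiples R v" "e \<in> units R" "h \<in> R" "g = e * u ^ n + h * v"
    by (auto simp: E_def)
  have "\<exists>c\<in>R. x - c * g \<in> multiples R v" if x: "x \<in> X" for x
  proof (cases "x \<in> multiples R v")
    case True
    then show ?thesis using closed(1) by (intro bexI[of _ 0]) auto
  next
    case False
    then obtain m where m: "E x m" using ex[OF x] by blast
    then obtain d h' where d: "d \<in> units R" "h' \<in> R" "x = d * u ^ m + h' * v" by (auto simp: E_def)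
    have "n \<le> m" unfolding n_def using m x by (blast intro: Least_le)
    define c where "c = d * inverse e * u ^ (m - n)"
    have c: "c \<in> R"
      unfolding c_def using d(1) g(3) u by (auto intro: closed unit_mem inverse_unit_mem)
    have "c * (e * u ^ n) = d * u ^ (m - n + n)"
      using units_nonzero[OF g(3)] by (simp add: c_def power_add field_simps)
    also have "m - n + n = m" using \<open>n \<le> m\<close> by simp
    finally have "x - c * g = (h' - c * h) * v" using g(5) d(3) by (simp add: algebra_simps)
    then show ?thesis
      using c d(2) g(4) by (intro bexI[of _ c] multiplesI[of "h' - c * h"]) (auto intro: closed)
  qed
  with that g(1,2) show ?thesis by blast
qed

lemma prime_avoiding_v:
  assumes Q: "prime_in R Q" "v \<notin> Q" "Q \<noteq> {0}"
  obtains g where "g \<in> Q" "g \<notin> multiples R v" "Q = multiples R g"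
proof -
  note ideal_Q = prime_in_ideal[OF Q(1)]
  note QR = ideal_in_subset[OF ideal_Q]
  have cancel: "a \<in> Q" if "a \<in> R" "a * v \<in> Q" for a
    using prime_in_mult[OF Q(1) that(1) v that(2)] Q(2) by blast
  have "\<not> Q \<subseteq> multiples R v"
  proof
    assume sub: "Q \<subseteq> multiples R v"
    have "Q \<subseteq> {0}"
    proof (rule descent[OF ideal_in_zero_ideal[OF subring] v_in_max QR])
      fix q assume "q \<in> Q"
      then obtain a where "a \<in> R" "q = a * v" using sub by (auto elim: multiplesE)
      then show "\<exists>x'\<in>Q. q - v * x' \<in> {0}"
        using cancel \<open>q \<in> Q\<close> by (intro bexI[of _ a]) auto
    qed
    then show False using Q(3) ideal_in_0[OF ideal_Q] by auto
  qed
  then obtain g where g: "g \<in> Q" "g \<notin> multiples R v"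
    "\<And>q. q \<in> Q \<Longrightarrow> \<exists>c\<in>R. q - c * g \<in> multiples R v"
    using exists_divisor_mod_v[OF QR] by metis
  have "g \<in> R" using g(1) QR by blast
  have "Q \<subseteq> multiples R g"
  proof (rule descent[OF ideal_in_multiples[OF subring \<open>g \<in> R\<close>] v_in_max QR])
    fix q assume q: "q \<in> Q"
    then obtain c a where c: "c \<in> R" "a \<in> R" "q - c * g = a * v" using g(3) by (meson multiplesE)
    have "q - c * g \<in> Q"
      using q g(1) c(1) by (intro ideal_in_diff[OF subring ideal_Q] ideal_in_mult_left[OF ideal_Q])
    then have "a \<in> Q" using cancel c by simp
    moreover have "q - v * a = c * g" using c(3) by (simp add: algebra_simps)
    ultimately show "\<exists>x'\<in>Q. q - v * x' \<in> multiples R g" using c(1) by (auto intro: multiplesI)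
  qed
  moreover have "multiples R g \<subseteq> Q" using ideal_Q g(1) by (rule multiples_least)
  ultimately show ?thesis using that g by blast
qed

lemma prime_eq_max:
  assumes Q: "prime_in R Q" and "v \<in> Q" "u ^ n \<in> Q"
  shows "Q = span2 R u v"
proof
  have "u \<in> Q" using prime_in_power[OF subring Q u assms(3)] .
  then show "span2 R u v \<subseteq> Q" using prime_in_ideal[OF Q] assms(2) by (intro span2_least)
  show "Q \<subseteq> span2 R u v" using Q by (intro proper_ideal_subset) (auto simp: prime_in_def)
qed

lemma prime_containing_v:
  assumes Q: "prime_in R Q" "v \<in> Q"
  shows "Q = multiples R v \<or> Q = span2 R u v"
proof (cases "Q \<subseteq> multiples R v")
  case True
  then show ?thesis using multiples_least[OF prime_in_ideal] Q by blast
next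
  case False
  note ideal_Q = prime_in_ideal[OF Q(1)]
  obtain h where h: "h \<in> Q" "h \<notin> multiples R v" using False by blast
  then obtain n e a where e: "e \<in> units R" "a \<in> R" "h = e * u ^ n + a * v"
    using u_power_expansion ideal_in_mem[OF ideal_Q] by blast
  have "inverse e * (h - a * v) \<in> Q"
    using h(1) e Q(2)
    by (intro ideal_in_mult_left[OF ideal_Q] ideal_in_diff[OF subring ideal_Q] inverse_unit_mem)
  also have "inverse e * (h - a * v) = u ^ n" using e(3) units_nonzero[OF e(1)] by simp
  finally show ?thesis using prime_eq_max Q by blast
qed

text \<open>An instance of Krull's principal ideal theorem: if the maximal ideal is the radical of
  \<open>v R\<close>, the dimension is at most one.\<close>

lemma prime_avoiding_v_if_u_power_in_v:
  assumes "u ^ d \<in> multiples R v" and Q: "prime_in R Q" "v \<notin> Q"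
  shows "Q = {0}"
proof (rule ccontr)
  assume "Q \<noteq> {0}"
  then obtain g where g: "g \<in> Q" "g \<notin> multiples R v" "Q = multiples R g"
    using prime_avoiding_v[OF Q] by blast
  have gR: "g \<in> R" using g(1) ideal_in_mem[OF prime_in_ideal[OF Q(1)]] by blast
  have "g \<in> span2 R u v" using g(1) prime_in_unit[OF Q(1)] gR units_eq by auto
  then obtain n e h where e: "n > 0" "e \<in> units R" "h \<in> R" "g = e * u ^ n + h * v"
    using max_ideal_expansion g(2) by blast
  define d where "d = (LEAST d. u ^ d \<in> multiples R v)"
  have ud: "u ^ d \<in> multiples R v" unfolding d_def using assms(1) by (rule LeastI)
  then obtain a where a: "a \<in> R" "u ^ d = a * v" by (rule multiplesE)
  have "n < d"
  proof (rule ccontr)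
    assume "\<not> n < d"
    then have "u ^ n = u ^ (n - d) * u ^ d" by (simp flip: power_add)
    then have "e * u ^ n = (e * u ^ (n - d)) * u ^ d" by simp
    also have "\<dots> \<in> multiples R v"
      using unit_mem[OF e(2)] u ud by (intro ideal_in_mult_left[OF ideal_v] closed)
    finally show False
      using g(2) e(3,4) ideal_in_add[OF ideal_v] by (auto intro: multiplesI)
  qed
  then have "e * u ^ d = e * u ^ n * u ^ (d - n)" by (simp flip: power_add)
  then have eq: "v * (e * a + h * u ^ (d - n)) = g * u ^ (d - n)"
    using a(2) e(4) by (simp add: algebra_simps)
  have mem: "e * a + h * u ^ (d - n) \<in> R"
    using a(1) unit_mem[OF e(2)] e(3) u by (intro closed)
  have "v * (e * a + h * u ^ (d - n)) \<in> Q"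
    unfolding eq using g(1) u by (intro ideal_in_mult_right[OF prime_in_ideal[OF Q(1)]] closed)
  then have "e * a + h * u ^ (d - n) \<in> multiples R g"
    using prime_in_mult[OF Q(1) v mem] Q(2) g(3) by blast
  then obtain t where t: "t \<in> R" "e * a + h * u ^ (d - n) = t * g" by (rule multiplesE)
  have "g \<noteq> 0" using g(2) ideal_in_0[OF ideal_v] by auto
  then have "u ^ (d - n) = t * v" using eq t(2) by (simp add: ac_simps)
  then have "u ^ (d - n) \<in> multiples R v" using t(1) by (rule multiplesI[rotated])
  then have "d \<le> d - n" unfolding d_def by (rule Least_le)
  then show False using \<open>n > 0\<close> \<open>n < d\<close> by simp
qed

lemma primes_if_u_power_in_v:
  assumes "u ^ d \<in> multiples R v" and Q: "prime_in R Q"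
  shows "Q = {0} \<or> Q = span2 R u v"
proof (cases "v \<in> Q")
  case True
  then have "u ^ d \<in> Q" using assms(1) multiples_least[OF prime_in_ideal[OF Q]] by blast
  then show ?thesis using prime_eq_max[OF Q True] by blast
qed (use prime_avoiding_v_if_u_power_in_v assms in blast)

lemma prime_v_if_no_u_power_in_v:
  assumes pow: "\<And>n. u ^ n \<notin> multiples R v"
  shows "prime_in R (multiples R v)"
proof (rule prime_inI[OF subring ideal_v])
  show "1 \<notin> multiples R v" using pow[of 0] by simp
  fix a b assume ab: "a \<in> R" "b \<in> R" "a * b \<in> multiples R v"
  show "a \<in> multiples R v \<or> b \<in> multiples R v"
  proof (rule ccontr)
    assume "\<not> ?thesis"
    then obtain m n d e h h' where expand: "d \<in> units R" "h \<in> R" "a = d * u ^ m + h * v"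
      "e \<in> units R" "h' \<in> R" "b = e * u ^ n + h' * v"
      using u_power_expansion[OF ab(1)] u_power_expansion[OF ab(2)] by blast
    have de: "inverse (d * e) \<in> R"
      using expand(1,4) by (intro inverse_unit_mem units_mult subring)
    have eq: "a * b - (h * b + d * u ^ m * h') * v = (d * e) * u ^ (m + n)"
      using expand(3,6) by (simp add: algebra_simps power_add)
    have "h * b + d * u ^ m * h' \<in> R"
      using expand(2,5) unit_mem[OF expand(1)] ab(2) u by (intro closed)
    then have "inverse (d * e) * (a * b - (h * b + d * u ^ m * h') * v) \<in> multiples R v"
      using ab(3) by (intro ideal_in_mult_left[OF ideal_v de] ideal_in_diff[OF subring ideal_v])
        (auto intro: multiplesI)
    also have "inverse (d * e) * (a * b - (h * b + d * u ^ m * h') * v) = u ^ (m + n)"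
      unfolding eq using units_nonzero[OF expand(1)] units_nonzero[OF expand(4)]
      by (simp add: field_simps)
    finally show False using pow by blast
  qed
qed

end

section \<open>Two-dimensional regular local rings\<close>

locale regular_parameters = two_gen_local +
  assumes v_nonzero: "v \<noteq> 0"
    and u_power: "u ^ n \<notin> multiples R v"
begin

lemma prime_v: "prime_in R (multiples R v)"
  using u_power by (rule prime_v_if_no_u_power_in_v)

lemma v_prime: "a \<in> R \<Longrightarrow> b \<in> R \<Longrightarrow> a * b \<in> multiples R v \<Longrightarrow> a \<in> multiples R v \<or> b \<in> multiples R v"
  using prime_v by (rule prime_in_mult)

lemma unit_notin_v: "e \<in> units R \<Longrightarrow> e \<notin> multiples R v"
  using prime_v by (rule prime_in_unit)

lemma u_nonzero: "u \<noteq> 0"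
  using u_power[of 1] ideal_in_0[OF ideal_v] by auto

lemma v_power_notin_u: "v ^ n \<notin> multiples R u"
proof (induction n)
  case 0
  have "multiples R u \<subseteq> span2 R u v" using ideal u_in_max by (rule multiples_least)
  then show ?case using proper by auto
next
  case (Suc n)
  show ?case
  proof
    assume "v ^ Suc n \<in> multiples R u"
    then obtain a where a: "a \<in> R" "v ^ Suc n = a * u" by (rule multiplesE)
    have "a * u \<in> multiples R v"
      using v by (intro multiplesI[of "v ^ n"]) (auto simp: closed a(2)[symmetric])
    then obtain b where "b \<in> R" "a = b * v"
      using v_prime[OF a(1) u] u_power[of 1] by (auto elim: multiplesE)
    then have "v ^ n \<in> multiples R u"
      using a(2) v_nonzero by (intro multiplesI[of b]) (auto simp: ac_simps)
    then show False using Suc.IH by blast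
  qed
qed

lemma swap: "regular_parameters R v u"
proof
  show "ideal_in R (span2 R v u)" "1 \<notin> span2 R v u"
    "\<And>r. r \<in> R \<Longrightarrow> r \<notin> span2 R v u \<Longrightarrow> inverse r \<in> R"
    using ideal proper unit by (simp_all add: span2_commute[of R v u])
qed (fact subring noeth u v u_nonzero v_power_notin_u)+

lemma v_adic_expansion:
  assumes "r \<in> R" "r \<noteq> 0"
  obtains n s where "s \<in> R" "s \<notin> multiples R v" "r = v ^ n * s"
proof -
  define X where "X = {r\<in>R. \<nexists>n s. s \<in> R \<and> s \<notin> multiples R v \<and> r = v ^ n * s}"
  have "X \<subseteq> {0}"
  proof (rule descent[OF ideal_in_zero_ideal[OF subring] v_in_max])
    fix r assume r: "r \<in> X"
    have "r = v ^ 0 * r" by simp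
    then have "r \<in> multiples R v" using r unfolding X_def by blast
    then obtain s where s: "s \<in> R" "r = s * v" by (rule multiplesE)
    have "s \<in> X"
    proof (rule ccontr)
      assume "s \<notin> X"
      then obtain n t where "t \<in> R" "t \<notin> multiples R v" "s = v ^ n * t"
        using s(1) unfolding X_def by blast
      moreover from this have "r = v ^ Suc n * t" using s(2) by simp
      ultimately show False using r unfolding X_def by blast
    qed
    then show "\<exists>x'\<in>X. r - v * x' \<in> {0}" using s by (intro bexI[of _ s]) auto
  qed (auto simp: X_def)
  then show ?thesis using that assms unfolding X_def by blast
qed

lemma prime_eq_max_or_multiples:
  assumes "prime_in R Q"
  shows "Q = span2 R u v \<or> (\<exists>g\<in>R. Q = multiples R g)"
proof -
  have "{0} = multiples R 0" using closed(1) by (auto simp: multiples_def)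
  moreover have "g \<in> R" if "g \<in> Q" for g
    using that prime_in_ideal[OF assms] by (auto dest: ideal_in_mem)
  ultimately show ?thesis
    using prime_containing_v[OF assms] prime_avoiding_v[OF assms] v closed(1) by metis
qed

lemma prime_below_multiples:
  assumes P: "prime_in R P" "P \<subset> multiples R g" and g: "g \<in> span2 R u v"
  shows "P = {0}"
proof -
  have gR: "g \<in> R" using g ideal_in_mem[OF ideal] by blast
  note ideal_P = prime_in_ideal[OF P(1)]
  have "g \<notin> P" using multiples_least[OF ideal_P, of g] P(2) by blast
  have "P \<subseteq> {0}"
  proof (rule descent[OF ideal_in_zero_ideal[OF subring] g ideal_in_subset[OF ideal_P]])
    fix p assume "p \<in> P"
    then obtain a where a: "a \<in> R" "p = a * g" using P(2) by (auto elim: multiplesE)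
    then have "a \<in> P" using prime_in_mult[OF P(1) a(1) gR] \<open>p \<in> P\<close> \<open>g \<notin> P\<close> by blast
    then show "\<exists>x'\<in>P. p - g * x' \<in> {0}" using a(2) by (intro bexI[of _ a]) auto
  qed
  then show ?thesis using ideal_in_0[OF ideal_P] by blast
qed

lemma prime_chain_2: "prime_chain R 2"
proof -
  define P :: "nat \<Rightarrow> 'a set" where
    "P = (\<lambda>i. if i = 0 then {0} else if i = 1 then multiples R v else span2 R u v)"
  have "{0} \<subset> multiples R v"
    using multiples_self[OF subring] v_nonzero ideal_in_0[OF ideal_v] by blast
  moreover have "multiples R v \<subset> span2 R u v"
    using multiples_least[OF ideal v_in_max] u_in_max u_power[of 1] by auto
  ultimately have "\<forall>i<2. P i \<subset> P (Suc i)" by (auto simp: P_def less_2_cases_iff)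
  moreover have "\<forall>i\<le>2. prime_in R (P i)"
    by (auto simp: P_def prime_in_zero[OF subring] prime_v prime_in_max)
  ultimately show ?thesis unfolding prime_chain_def by blast
qed

lemma no_prime_chain_3: "\<not> prime_chain R 3"
proof
  assume "prime_chain R 3"
  then obtain P where P: "\<And>i. i \<le> 3 \<Longrightarrow> prime_in R (P i)" "\<And>i. i < 3 \<Longrightarrow> P i \<subset> P (Suc i)"
    unfolding prime_chain_def by blast
  have lt: "P 0 \<subset> P 1" "P 1 \<subset> P 2" "P 2 \<subset> P 3"
    using P(2)[of 0] P(2)[of 1] P(2)[of 2] by (auto simp: numeral_eq_Suc)
  have "P 3 \<subseteq> span2 R u v"
    using P(1)[of 3] by (intro proper_ideal_subset) (auto simp: prime_in_def)
  then have "P 2 \<subset> span2 R u v" using lt(3) by blast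
  then obtain g where "g \<in> R" "P 2 = multiples R g"
    using prime_eq_max_or_multiples[OF P(1), of 2] by auto
  then have "P 1 = {0}"
    using prime_below_multiples[OF P(1)[of 1], of g] lt(2) \<open>P 2 \<subset> span2 R u v\<close>
      multiples_self[OF subring, of g]
    by auto
  moreover have "0 \<in> P 0" using ideal_in_0[OF prime_in_ideal[OF P(1)]] by simp
  ultimately show False using lt(1) by auto
qed

lemma regular_local2: "regular_local2 R"
proof -
  have "max_ideal R = ideal_gen R {u, v}" using max_ideal ideal_gen_pair[OF subring u v] by simp
  moreover have "krull_dim_eq R 2"
    using prime_chain_2 no_prime_chain_3 by (simp add: krull_dim_eq_def numeral_eq_Suc)
  ultimately show ?thesis
    unfolding regular_local2_def using local_ring noeth u v by blast
qed

end

lemma regular_parameters_of_regular_local2: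
  assumes R: "regular_local2 R" and uv: "u \<in> R" "v \<in> R" "max_ideal R = ideal_gen R {u, v}"
  shows "regular_parameters R u v"
proof -
  have R': "noetherian R" "local_ring R" "prime_chain R 2"
    using R by (auto simp: regular_local2_def krull_dim_eq_def)
  note local = noetherian_local_subring[OF R'(1,2)]
  have M: "max_ideal R = span2 R u v"
    using ideal_gen_pair[OF local_subring.subring[OF local]] uv by simp
  have no_power: "b ^ d \<notin> multiples R c"
    if bc: "b \<in> R" "c \<in> R" "max_ideal R = span2 R b c" for b c d
  proof
    assume pow: "b ^ d \<in> multiples R c"
    interpret two_gen_local R b c
      using local R'(1) bc by (simp add: two_gen_local_def two_gen_local_axioms_def)
    obtain P where P: "\<And>i. i \<le> 2 \<Longrightarrow> prime_in R (P i)" "\<And>i. i < 2 \<Longrightarrow> P i \<subset> P (Suc i)"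
      using R'(3) unfolding prime_chain_def by blast
    have lt: "P 0 \<subset> P 1" "P 1 \<subset> P 2" using P(2)[of 0] P(2)[of 1] by (auto simp: numeral_eq_Suc)
    have "0 \<in> P 0" using ideal_in_0[OF prime_in_ideal[OF P(1)]] by simp
    moreover have "P 2 \<subseteq> span2 R b c"
      using P(1)[of 2] by (intro proper_ideal_subset) (auto simp: prime_in_def)
    ultimately show False using primes_if_u_power_in_v[OF pow P(1)[of 1]] lt by auto
  qed
  interpret two_gen_local R u v
    using local R'(1) uv M by (simp add: two_gen_local_def two_gen_local_axioms_def)
  show ?thesis
  proof
    show "u ^ n \<notin> multiples R v" for n using no_power[OF uv(1,2) M] .
    show "v \<noteq> 0"
      using no_power[OF uv(2,1), of 1] M ideal_in_0[OF ideal_in_multiples[OF subring u]]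
      by (auto simp: span2_commute)
  qed
qed

context regular_parameters
begin

lemma mod_v_proportional:
  assumes mem: "a \<in> R" "b \<in> R" "a' \<in> R" "b' \<in> R" "c \<in> R"
    and eq: "a * b' = a' * b" and a: "a \<notin> multiples R v" "a' - c * a \<in> multiples R v"
  shows "b' - c * b \<in> multiples R v"
proof -
  have "a * (b' - c * b) = b * (a' - c * a)" using eq by (simp add: algebra_simps)
  also have "\<dots> \<in> multiples R v" using mem(2) a(2) by (rule ideal_in_mult_left[OF ideal_v])
  finally show ?thesis using v_prime[OF mem(1), of "b' - c * b"] mem a(1) by (auto intro: closed)
qed

lemma denominator_nonzero_mod_v:
  assumes "q \<in> R" "q \<noteq> 0" "q * f \<in> R"
  shows "\<exists>s\<in>R. s * f \<in> R \<and> (s \<notin> multiples R v \<or> s * f \<notin> multiples R v)"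
proof (rule ccontr)
  assume no: "\<not> ?thesis"
  define J where "J = {s\<in>R. s * f \<in> R}"
  have "J \<subseteq> {0}"
  proof (rule descent[OF ideal_in_zero_ideal[OF subring] v_in_max])
    fix s assume "s \<in> J"
    then have "s \<in> multiples R v" "s * f \<in> multiples R v" using no by (auto simp: J_def)
    then obtain a b where ab: "a \<in> R" "b \<in> R" "s = a * v" "s * f = b * v"
      by (auto elim!: multiplesE)
    then have "a * f = b" using v_nonzero by auto
    then show "\<exists>x'\<in>J. s - v * x' \<in> {0}" using ab by (intro bexI[of _ a]) (auto simp: J_def)
  qed (auto simp: J_def)
  then show False using assms by (auto simp: J_def)
qed

text \<open>The denominators of \<^term>\<open>f\<close> form a principal ideal: modulo \<^term>\<open>v\<close> the pairs
  \<^term>\<open>(s, s * f)\<close> form a rank one module over a discrete valuation ring.\<close>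

lemma denominator_generates_mod_v:
  assumes "q \<in> R" "q \<noteq> 0" "q * f \<in> R"
  obtains d where "d \<in> R" "d * f \<in> R" "\<And>s. s \<in> R \<Longrightarrow> s * f \<in> R \<Longrightarrow>
    \<exists>c\<in>R. s - c * d \<in> multiples R v \<and> s * f - c * (d * f) \<in> multiples R v"
proof -
  define J where "J = {s\<in>R. s * f \<in> R}"
  define X where "X = J \<union> (\<lambda>s. s * f) ` J"
  have "X \<subseteq> R" "\<not> X \<subseteq> multiples R v"
    using denominator_nonzero_mod_v[OF assms] by (auto simp: X_def J_def)
  then obtain g where g: "g \<in> X" "g \<notin> multiples R v"
    "\<And>x. x \<in> X \<Longrightarrow> \<exists>c\<in>R. x - c * g \<in> multiples R v"
    using exists_divisor_mod_v by metis
  then obtain d where d: "d \<in> R" "d * f \<in> R" "g = d \<or> g = d * f" by (auto simp: X_def J_def)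
  show ?thesis
  proof (rule that[OF d(1,2)])
    fix s assume s: "s \<in> R" "s * f \<in> R"
    show "\<exists>c\<in>R. s - c * d \<in> multiples R v \<and> s * f - c * (d * f) \<in> multiples R v"
      using d(3)
    proof
      assume "g = d"
      then obtain c where c: "c \<in> R" "s - c * d \<in> multiples R v"
        using g(3)[of s] s by (auto simp: X_def J_def)
      then have "s * f - c * (d * f) \<in> multiples R v"
        using d s g(2) \<open>g = d\<close> by (intro mod_v_proportional[of d "d * f" s "s * f"]) auto
      with c show ?thesis by blast
    next
      assume "g = d * f"
      then obtain c where c: "c \<in> R" "s * f - c * (d * f) \<in> multiples R v"
        using g(3)[of "s * f"] s by (auto simp: X_def J_def)
      then have "s - c * d \<in> multiples R v"
        using d s g(2) \<open>g = d * f\<close> by (intro mod_v_proportional[of "d * f" d "s * f" s]) auto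
      with c show ?thesis by blast
    qed
  qed
qed

lemma reduced_denominator:
  assumes q: "q \<in> R" "q \<noteq> 0" "q * f \<in> R"
  obtains d where "d \<in> R" "d \<noteq> 0" "d * f \<in> R" "{s\<in>R. s * f \<in> R} \<subseteq> multiples R d"
proof -
  obtain d where d: "d \<in> R" "d * f \<in> R" and mod_v: "\<And>s. s \<in> R \<Longrightarrow> s * f \<in> R \<Longrightarrow>
    \<exists>c\<in>R. s - c * d \<in> multiples R v \<and> s * f - c * (d * f) \<in> multiples R v"
    using denominator_generates_mod_v[OF q] by metis
  have sub: "{s\<in>R. s * f \<in> R} \<subseteq> multiples R d"
  proof (rule descent[OF ideal_in_multiples[OF subring d(1)] v_in_max])
    fix s assume "s \<in> {s\<in>R. s * f \<in> R}"
    then obtain c a b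
      where c: "c \<in> R" "a \<in> R" "b \<in> R" "s - c * d = a * v" "s * f - c * (d * f) = b * v"
      using mod_v[of s] by (auto elim!: multiplesE)
    have "(a * f) * v = b * v" using c(4,5) by (metis left_diff_distrib mult.assoc mult.commute)
    then have "a * f = b" using v_nonzero by simp
    moreover have "s - v * a = c * d" using c(4) by (simp add: algebra_simps)
    ultimately show "\<exists>x'\<in>{s\<in>R. s * f \<in> R}. s - v * x' \<in> multiples R d"
      using c(1-3) by (intro bexI[of _ a]) (auto intro: multiplesI)
  qed auto
  then have "q \<in> multiples R d" using q by blast
  then have "d \<noteq> 0" using q(2) by (auto elim: multiplesE)
  with that d sub show ?thesis by blast
qed

end

section \<open>Polynomials over a subring and the Hilbert basis theorem\<close>

definition polys :: "'a::field set \<Rightarrow> 'a poly set" where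
  "polys R = {p. \<forall>i. coeff p i \<in> R}"

lemma polys_coeff: "p \<in> polys R \<Longrightarrow> coeff p i \<in> R"
  by (simp add: polys_def)

lemma polys_add: "subring R \<Longrightarrow> p \<in> polys R \<Longrightarrow> q \<in> polys R \<Longrightarrow> p + q \<in> polys R"
  and polys_diff: "subring R \<Longrightarrow> p \<in> polys R \<Longrightarrow> q \<in> polys R \<Longrightarrow> p - q \<in> polys R"
  and polys_mult: "subring R \<Longrightarrow> p \<in> polys R \<Longrightarrow> q \<in> polys R \<Longrightarrow> p * q \<in> polys R"
  and polys_smult: "subring R \<Longrightarrow> c \<in> R \<Longrightarrow> p \<in> polys R \<Longrightarrow> smult c p \<in> polys R"
  and polys_monom: "subring R \<Longrightarrow> c \<in> R \<Longrightarrow> monom c n \<in> polys R"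
  and polys_zero: "subring R \<Longrightarrow> 0 \<in> polys R"
  by (auto simp: polys_def coeff_mult intro: subring_closed subring_sum)

lemma polys_pCons: "pCons c p \<in> polys R \<longleftrightarrow> c \<in> R \<and> p \<in> polys R"
  by (auto simp: polys_def coeff_pCons split: nat.splits)

lemma polys_linear: "subring R \<Longrightarrow> a \<in> R \<Longrightarrow> b \<in> R \<Longrightarrow> [:a, b:] \<in> polys R"
  by (simp add: polys_pCons polys_zero)

lemma polys_one: "subring R \<Longrightarrow> 1 \<in> polys R"
  by (simp add: one_pCons polys_pCons polys_zero subring_one)

lemma polys_pcompose: "subring R \<Longrightarrow> p \<in> polys R \<Longrightarrow> q \<in> polys R \<Longrightarrow> pcompose p q \<in> polys R"
  by (induction p) (auto simp: pcompose_pCons polys_pCons intro!: polys_add polys_mult polys_zero)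

lemma polys_mono: "R \<subseteq> T \<Longrightarrow> polys R \<subseteq> polys T"
  by (auto simp: polys_def)

lemma poly_mem_subring: "subring R \<Longrightarrow> p \<in> polys R \<Longrightarrow> w \<in> R \<Longrightarrow> poly p w \<in> R"
  by (induction p) (auto simp: polys_pCons intro: subring_closed)

lemma order_factor:
  fixes p :: "'a::field poly"
  assumes "p \<noteq> 0"
  obtains q where "p = [:- a, 1:] ^ order a p * q" "poly q a \<noteq> 0"
  using order_decomp[OF assms, of a] by (auto simp: poly_eq_0_iff_dvd)

lemma polys_divide_linear:
  assumes k: "subring k" "a \<in> k" and p: "[:- a, 1:] * p \<in> polys k"
  shows "p \<in> polys k"
proof -
  have "coeff p i \<in> k" if "m = Suc (degree p) - i" for m i
    using that
  proof (induction m arbitrary: i)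
    case 0
    then show ?case using k by (simp add: coeff_eq_0 subring_zero)
  next
    case (Suc m)
    have "coeff p i = coeff ([:- a, 1:] * p) (Suc i) + a * coeff p (Suc i)" by simp
    moreover have "coeff p (Suc i) \<in> k" using Suc by auto
    ultimately show ?case
      using k polys_coeff[OF p] by (simp only: subring_add subring_mult)
  qed
  then show ?thesis by (auto simp: polys_def)
qed

lemma polys_divide_linear_power:
  assumes "subring k" "a \<in> k"
  shows "[:- a, 1:] ^ n * p \<in> polys k \<Longrightarrow> p \<in> polys k"
proof (induction n)
  case (Suc n)
  then show ?case
    using polys_divide_linear[OF assms, of "[:- a, 1:] ^ n * p"]
    by (simp only: power_Suc mult.assoc)
qed simp

lemma adjoin_superset: "R \<union> S \<subseteq> adjoin R S"
  and adjoin_least: "subring T \<Longrightarrow> R \<subseteq> T \<Longrightarrow> S \<subseteq> T \<Longrightarrow> adjoin R S \<subseteq> T"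
  by (auto simp: adjoin_def)

lemma adjoin_base: "r \<in> R \<Longrightarrow> r \<in> adjoin R S"
  and adjoin_gen: "s \<in> S \<Longrightarrow> s \<in> adjoin R S"
  using adjoin_superset[of R S] by auto

lemma subring_adjoin: "subring (adjoin R S)"
  unfolding subring_def adjoin_def by (auto intro: subring_closed)

lemma adjoin_singleton:
  assumes R: "subring R"
  shows "adjoin R {w} = (\<lambda>p. poly p w) ` polys R" (is "_ = ?P")
proof
  have "subring ?P"
    unfolding subring_def
  proof (intro conjI ballI)
    show "0 \<in> ?P" "1 \<in> ?P"
      using polys_zero[OF R] polys_one[OF R]
      by (force intro: image_eqI[of _ _ 0] image_eqI[of _ _ 1])+
    fix a b assume "a \<in> ?P" "b \<in> ?P"
    then obtain p q where pq: "p \<in> polys R" "q \<in> polys R" "a = poly p w" "b = poly q w" by auto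
    show "a + b \<in> ?P" by (rule image_eqI[of _ _ "p + q"]) (use R pq polys_add in auto)
    show "a - b \<in> ?P" by (rule image_eqI[of _ _ "p - q"]) (use R pq polys_diff in auto)
    show "a * b \<in> ?P" by (rule image_eqI[of _ _ "p * q"]) (use R pq polys_mult in auto)
  qed
  moreover have "r \<in> ?P" if "r \<in> R" for r
    by (rule image_eqI[of _ _ "[:r:]"]) (use R that in \<open>auto simp: polys_pCons polys_zero\<close>)
  moreover have "w \<in> ?P"
    by (rule image_eqI[of _ _ "[:0, 1:]"]) (use R in \<open>auto intro: polys_linear subring_closed\<close>)
  ultimately show "adjoin R {w} \<subseteq> ?P"
    by (intro adjoin_least) auto
  have "polys R \<subseteq> polys (adjoin R {w})"
    by (intro polys_mono) (auto intro: adjoin_base)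
  then show "?P \<subseteq> adjoin R {w}"
    by (auto intro: poly_mem_subring[OF subring_adjoin] adjoin_gen)
qed

lemma adjoin_singletonE:
  assumes "subring R" "q \<in> adjoin R {w}"
  obtains p where "p \<in> polys R" "q = poly p w"
  using assms adjoin_singleton by blast

definition poly_ideal :: "'a::field set \<Rightarrow> 'a poly set \<Rightarrow> bool" where
  "poly_ideal R J \<longleftrightarrow> J \<subseteq> polys R \<and> 0 \<in> J \<and> (\<forall>p\<in>J. \<forall>q\<in>J. p + q \<in> J) \<and>
     (\<forall>c\<in>R. \<forall>p\<in>J. smult c p \<in> J) \<and> (\<forall>p\<in>J. pCons 0 p \<in> J)"

definition leading_coeffs :: "'a::field poly set \<Rightarrow> nat \<Rightarrow> 'a set" where
  "leading_coeffs J n = (\<lambda>p. coeff p n) ` {p\<in>J. degree p \<le> n}"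

lemma leading_coeffsI: "p \<in> J \<Longrightarrow> degree p \<le> n \<Longrightarrow> c = coeff p n \<Longrightarrow> c \<in> leading_coeffs J n"
  by (auto simp: leading_coeffs_def)

lemma leading_coeffsE:
  assumes "c \<in> leading_coeffs J n"
  obtains p where "p \<in> J" "degree p \<le> n" "c = coeff p n"
  using assms by (auto simp: leading_coeffs_def)

lemma ideal_in_leading_coeffs:
  assumes J: "poly_ideal R J"
  shows "ideal_in R (leading_coeffs J n)"
proof (rule ideal_inI)
  show "leading_coeffs J n \<subseteq> R"
    using J by (auto simp: poly_ideal_def leading_coeffs_def dest: polys_coeff)
  show "0 \<in> leading_coeffs J n"
    using J by (intro leading_coeffsI[of 0]) (auto simp: poly_ideal_def)
next
  fix a b assume "a \<in> leading_coeffs J n" "b \<in> leading_coeffs J n"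
  then obtain p q
    where "p \<in> J" "degree p \<le> n" "a = coeff p n" "q \<in> J" "degree q \<le> n" "b = coeff q n"
    by (auto elim!: leading_coeffsE)
  then show "a + b \<in> leading_coeffs J n"
    using J by (intro leading_coeffsI[of "p + q"]) (auto simp: poly_ideal_def degree_add_le)
next
  fix r a assume "r \<in> R" "a \<in> leading_coeffs J n"
  then obtain p where "p \<in> J" "degree p \<le> n" "a = coeff p n" by (auto elim: leading_coeffsE)
  then show "r * a \<in> leading_coeffs J n"
    using J \<open>r \<in> R\<close>
    by (intro leading_coeffsI[of "smult r p"])
      (auto simp: poly_ideal_def le_trans[OF degree_smult_le])
qed

lemma leading_coeffs_Suc: "poly_ideal R J \<Longrightarrow> leading_coeffs J n \<subseteq> leading_coeffs J (Suc n)"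
  by (auto elim!: leading_coeffsE intro!: leading_coeffsI[of "pCons 0 _"]
      simp: poly_ideal_def le_trans[OF degree_pCons_le])

lemma leading_coeffs_mono:
  assumes "poly_ideal R J" "m \<le> n"
  shows "leading_coeffs J m \<subseteq> leading_coeffs J n"
  using leading_coeffs_Suc[OF assms(1)] assms(2) by (rule lift_Suc_mono_le)

lemma poly_ideal_diff:
  assumes "subring R" "poly_ideal R J" "p \<in> J" "q \<in> J"
  shows "p - q \<in> J"
proof -
  have "- 1 \<in> R" using assms(1) by (intro subring_closed)
  then have "p + smult (- 1) q \<in> J" using assms(2-4) unfolding poly_ideal_def by blast
  then show ?thesis by simp
qed

lemma poly_ideal_Int: "poly_ideal R J \<Longrightarrow> poly_ideal R H \<Longrightarrow> poly_ideal R (J \<inter> H)"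
  by (auto simp: poly_ideal_def)

lemma poly_ideal_subset_of_leading_coeffs:
  assumes R: "subring R" and J: "poly_ideal R J" and H: "poly_ideal R H" "H \<subseteq> J"
    and lead: "\<And>n. leading_coeffs J n \<subseteq> leading_coeffs H n"
  shows "J \<subseteq> H"
proof
  fix p assume "p \<in> J"
  then show "p \<in> H"
  proof (induction "degree p" arbitrary: p rule: less_induct)
    case less
    have "coeff p (degree p) \<in> leading_coeffs H (degree p)"
      using lead leading_coeffsI[OF less.prems order_refl refl] by blast
    then obtain q where q: "q \<in> H" "degree q \<le> degree p" "coeff p (degree p) = coeff q (degree p)"
      by (rule leading_coeffsE)
    have "p - q \<in> J" using R J less.prems q(1) H(2) by (blast intro: poly_ideal_diff)
    have "p - q \<in> H"
    proof (cases "p - q = 0")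
      case True
      then show ?thesis using H(1) by (simp add: poly_ideal_def)
    next
      case False
      have "coeff (p - q) (degree p) = 0" using q(3) by simp
      then have "degree (p - q) \<noteq> degree p" using False by (metis leading_coeff_0_iff)
      then have "degree (p - q) < degree p" using degree_diff_le[OF order_refl q(2)] by simp
      then show ?thesis using less.hyps \<open>p - q \<in> J\<close> by blast
    qed
    then have "(p - q) + q \<in> H" using H(1) q(1) unfolding poly_ideal_def by blast
    then show ?case by simp
  qed
qed

lemma hilbert_basis:
  assumes R: "noetherian R" and J: "poly_ideal R J"
  shows "\<exists>B\<subseteq>J. finite B \<and> (\<forall>H. poly_ideal R H \<and> B \<subseteq> H \<longrightarrow> J \<subseteq> H)"
proof -
  let ?L = "leading_coeffs J"
  obtain N where N: "\<And>n. n \<ge> N \<Longrightarrow> ?L n = ?L N"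
    using noetherian_stable[of R ?L, OF R ideal_in_leading_coeffs[OF J] leading_coeffs_Suc[OF J]]
    by blast
  have "\<exists>B\<subseteq>{p\<in>J. degree p \<le> n}. finite B \<and> ?L n = ideal_gen R ((\<lambda>p. coeff p n) ` B)" for n
  proof -
    obtain S where S: "finite S" "?L n = ideal_gen R S"
      using R ideal_in_leading_coeffs[OF J] unfolding noetherian_def by blast
    have "S \<subseteq> (\<lambda>p. coeff p n) ` {p\<in>J. degree p \<le> n}"
      using ideal_gen_superset[of S R] S(2) by (simp add: leading_coeffs_def)
    then show ?thesis using S by (metis (no_types, lifting) finite_subset_image)
  qed
  then obtain B where B: "\<And>n. B n \<subseteq> {p\<in>J. degree p \<le> n}" "\<And>n. finite (B n)"
    "\<And>n. ?L n = ideal_gen R ((\<lambda>p. coeff p n) ` B n)"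
    by metis
  have "J \<subseteq> H" if H: "poly_ideal R H" "(\<Union>n\<le>N. B n) \<subseteq> H" for H
  proof -
    have JH: "poly_ideal R (J \<inter> H)" using J H(1) by (rule poly_ideal_Int)
    have low: "?L n \<subseteq> leading_coeffs (J \<inter> H) n" if "n \<le> N" for n
      unfolding B(3)
      using B(1)[of n] H(2) that
      by (intro ideal_gen_least[OF ideal_in_leading_coeffs[OF JH]]) (auto intro!: leading_coeffsI)
    have "?L n \<subseteq> leading_coeffs (J \<inter> H) n" for n
    proof (cases "n \<le> N")
      case False
      then show ?thesis
        using N[of n] low[of N] leading_coeffs_mono[OF JH, of N n] by simp
    qed (rule low)
    then have "J \<subseteq> J \<inter> H"
      by (intro poly_ideal_subset_of_leading_coeffs[OF noetherian_subring[OF R] J JH]) auto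
    then show ?thesis by blast
  qed
  moreover have "(\<Union>n\<le>N. B n) \<subseteq> J" "finite (\<Union>n\<le>N. B n)" using B(1,2) by auto
  ultimately show ?thesis by blast
qed

lemma poly_ideal_vimage:
  assumes R: "subring R" and I: "ideal_in (adjoin R {w}) I"
  shows "poly_ideal R {p \<in> polys R. poly p w \<in> I}" (is "poly_ideal R ?J")
  unfolding poly_ideal_def
proof (intro conjI ballI)
  show "0 \<in> ?J" using polys_zero[OF R] ideal_in_0[OF I] by simp
  show "p + q \<in> ?J" if "p \<in> ?J" "q \<in> ?J" for p q
    using that polys_add[OF R] ideal_in_add[OF I] by simp
  show "smult c p \<in> ?J" if "c \<in> R" "p \<in> ?J" for c p
    using that polys_smult[OF R] ideal_in_mult_left[OF I] by (simp add: adjoin_base)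
  show "pCons 0 p \<in> ?J" if "p \<in> ?J" for p
    using that ideal_in_mult_left[OF I] by (simp add: polys_pCons subring_zero[OF R] adjoin_gen)
qed auto

lemma noetherian_adjoin_singleton:
  assumes R: "noetherian R"
  shows "noetherian (adjoin R {w})"
  unfolding noetherian_def
proof (intro conjI allI impI)
  let ?A = "adjoin R {w}"
  note subring = noetherian_subring[OF R]
  show "subring ?A" by (rule subring_adjoin)
  fix I assume I: "ideal_in ?A I"
  define J where "J = {p \<in> polys R. poly p w \<in> I}"
  have "poly_ideal R J" unfolding J_def using subring I by (rule poly_ideal_vimage)
  then obtain B where B: "B \<subseteq> J" "finite B" "\<And>H. poly_ideal R H \<and> B \<subseteq> H \<Longrightarrow> J \<subseteq> H"
    using hilbert_basis[OF R] by metis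
  define S where "S = (\<lambda>p. poly p w) ` B"
  have SI: "S \<subseteq> I" using B(1) by (auto simp: S_def J_def)
  then have SA: "S \<subseteq> ?A" using ideal_in_subset[OF I] by blast
  let ?H = "{p \<in> polys R. poly p w \<in> ideal_gen ?A S}"
  have "B \<subseteq> ?H" using B(1) ideal_gen_superset[of S ?A] by (auto simp: S_def J_def)
  then have "J \<subseteq> ?H"
    by (intro B(3) conjI poly_ideal_vimage subring ideal_in_ideal_gen subring_adjoin SA)
  moreover have "\<exists>p\<in>J. a = poly p w" if "a \<in> I" for a
    using adjoin_singletonE[OF subring ideal_in_mem[OF I that]] that unfolding J_def by blast
  ultimately have "I \<subseteq> ideal_gen ?A S" by blast
  moreover have "ideal_gen ?A S \<subseteq> I" using I SI by (rule ideal_gen_least)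
  ultimately show "\<exists>S. finite S \<and> S \<subseteq> ?A \<and> I = ideal_gen ?A S"
    using B(2) SA by (intro exI[of _ S]) (auto simp: S_def)
qed

section \<open>Localization\<close>

lemma localizeI: "r \<in> A \<Longrightarrow> s \<in> A \<Longrightarrow> s \<notin> P \<Longrightarrow> f = r / s \<Longrightarrow> f \<in> localize A P"
  by (auto simp: localize_def)

lemma localizeE:
  assumes "f \<in> localize A P"
  obtains r s where "r \<in> A" "s \<in> A" "s \<notin> P" "f = r / s"
  using assms by (auto simp: localize_def)

definition localize_ideal :: "'a::field set \<Rightarrow> 'a set \<Rightarrow> 'a set \<Rightarrow> 'a set" where
  "localize_ideal A P I = {r / s | r s. r \<in> I \<and> s \<in> A \<and> s \<notin> P}"

lemma localize_idealI: "r \<in> I \<Longrightarrow> s \<in> A \<Longrightarrow> s \<notin> P \<Longrightarrow> f = r / s \<Longrightarrow> f \<in> localize_ideal A P I"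
  by (auto simp: localize_ideal_def)

lemma localize_idealE:
  assumes "f \<in> localize_ideal A P I"
  obtains r s where "r \<in> I" "s \<in> A" "s \<notin> P" "f = r / s"
  using assms by (auto simp: localize_ideal_def)

locale prime_localization =
  fixes A P :: "'a::field set"
  assumes subring_base: "subring A" and prime: "prime_in A P"
begin

lemma one_notin: "1 \<notin> P"
  using prime by (rule prime_in_one)

lemma mult_notin: "s \<in> A \<Longrightarrow> t \<in> A \<Longrightarrow> s \<notin> P \<Longrightarrow> t \<notin> P \<Longrightarrow> s * t \<notin> P"
  using prime_in_mult[OF prime] by blast

lemma nonzero: "s \<notin> P \<Longrightarrow> s \<noteq> 0"
  using ideal_in_0[OF prime_in_ideal[OF prime]] by auto

lemma superset: "A \<subseteq> localize A P"
  using subring_one[OF subring_base] one_notin by (auto intro: localizeI[of _ A 1])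

lemma unit_localize:
  assumes "s \<in> A" "s \<notin> P"
  shows "s \<in> units (localize A P)"
proof (rule unitsI)
  show "s \<in> localize A P" using assms(1) superset by blast
  show "inverse s \<in> localize A P"
    using assms subring_one[OF subring_base]
    by (intro localizeI[of 1 A s]) (auto simp: divide_inverse)
qed (use assms(2) nonzero in blast)

lemma subring_localize: "subring (localize A P)"
  unfolding subring_def
proof (intro conjI ballI)
  show "0 \<in> localize A P" "1 \<in> localize A P"
    using superset subring_base by (auto intro: subring_closed)
  fix f g assume "f \<in> localize A P" "g \<in> localize A P"
  then obtain a s b t
    where fg: "a \<in> A" "s \<in> A" "s \<notin> P" "f = a / s" "b \<in> A" "t \<in> A" "t \<notin> P" "g = b / t"
    by (auto elim!: localizeE)
  then have st: "s * t \<in> A" "s * t \<notin> P" using mult_notin subring_mult[OF subring_base] by auto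
  have nz: "s \<noteq> 0" "t \<noteq> 0" using fg nonzero by auto
  show "f + g \<in> localize A P"
    by (rule localizeI[of "a * t + b * s" _ "s * t"])
      (use fg st nz in \<open>auto simp: field_simps intro: subring_closed[OF subring_base]\<close>)
  show "f - g \<in> localize A P"
    by (rule localizeI[of "a * t - b * s" _ "s * t"])
      (use fg st nz in \<open>auto simp: field_simps intro: subring_closed[OF subring_base]\<close>)
  show "f * g \<in> localize A P"
    by (rule localizeI[of "a * b" _ "s * t"])
      (use fg st in \<open>auto intro: subring_mult[OF subring_base]\<close>)
qed

lemma noetherian_localize:
  assumes "noetherian A"
  shows "noetherian (localize A P)"
  unfolding noetherian_def
proof (intro conjI allI impI subring_localize)
  let ?L = "localize A P"
  fix I assume I: "ideal_in ?L I"
  obtain S where S: "finite S" "S \<subseteq> A" "A \<inter> I = ideal_gen A S"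
    using assms ideal_in_contraction[OF subring_base superset I] unfolding noetherian_def by blast
  have SL: "S \<subseteq> ?L" using S(2) superset by blast
  have ideal: "ideal_in ?L (ideal_gen ?L S)"
    using subring_localize SL by (rule ideal_in_ideal_gen)
  have "ideal_gen A S \<subseteq> A \<inter> ideal_gen ?L S"
    using ideal_in_contraction[OF subring_base superset ideal] S(2) ideal_gen_superset[of S ?L]
    by (intro ideal_gen_least) auto
  then have contract: "A \<inter> I \<subseteq> ideal_gen ?L S" using S(3) by blast
  have "I \<subseteq> ideal_gen ?L S"
  proof
    fix f assume f: "f \<in> I"
    then obtain r s where rs: "r \<in> A" "s \<in> A" "s \<notin> P" "f = r / s"
      using ideal_in_mem[OF I] by (blast elim: localizeE)
    then have "s * f = r" using nonzero by simp
    then have "r \<in> ideal_gen ?L S"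
      using ideal_in_mult_left[OF I _ f, of s] rs(1,2) superset contract by blast
    then have "inverse s * r \<in> ideal_gen ?L S"
      using ideal_in_mult_left[OF ideal units_inverse_mem[OF unit_localize]] rs(2,3) by blast
    then show "f \<in> ideal_gen ?L S" using rs(4) by (simp add: field_simps)
  qed
  moreover have "ideal_gen ?L S \<subseteq> I"
    using S(3) ideal_gen_superset[of S A] by (intro ideal_gen_least[OF I]) blast
  ultimately show "\<exists>S. finite S \<and> S \<subseteq> ?L \<and> I = ideal_gen ?L S" using S(1) SL by blast
qed

lemma localize_ideal_superset: "I \<subseteq> localize_ideal A P I"
  using subring_one[OF subring_base] one_notin by (auto intro: localize_idealI[of _ _ 1])

lemma ideal_in_localize_ideal:
  assumes I: "ideal_in A I"
  shows "ideal_in (localize A P) (localize_ideal A P I)"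
proof (rule ideal_inI)
  show "localize_ideal A P I \<subseteq> localize A P"
    using ideal_in_mem[OF I] by (auto elim!: localize_idealE intro: localizeI)
  show "0 \<in> localize_ideal A P I"
    using ideal_in_0[OF I] localize_ideal_superset by blast
next
  fix f g assume "f \<in> localize_ideal A P I" "g \<in> localize_ideal A P I"
  then obtain a s b t
    where fg: "a \<in> I" "s \<in> A" "s \<notin> P" "f = a / s" "b \<in> I" "t \<in> A" "t \<notin> P" "g = b / t"
    by (auto elim!: localize_idealE)
  show "f + g \<in> localize_ideal A P I"
  proof (rule localize_idealI)
    show "f + g = (t * a + s * b) / (s * t)"
      using fg nonzero[of s] nonzero[of t] by (simp add: field_simps)
    show "t * a + s * b \<in> I" using fg by (intro ideal_in_add[OF I] ideal_in_mult_left[OF I])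
  qed (use fg mult_notin subring_mult[OF subring_base] in auto)
next
  fix f g assume "f \<in> localize A P" "g \<in> localize_ideal A P I"
  then obtain a s b t
    where fg: "a \<in> A" "s \<in> A" "s \<notin> P" "f = a / s" "b \<in> I" "t \<in> A" "t \<notin> P" "g = b / t"
    by (auto elim!: localizeE localize_idealE)
  show "f * g \<in> localize_ideal A P I"
  proof (rule localize_idealI)
    show "f * g = (a * b) / (s * t)" using fg by simp
    show "a * b \<in> I" using fg by (intro ideal_in_mult_left[OF I])
  qed (use fg mult_notin subring_mult[OF subring_base] in auto)
qed

lemma local_subring_localize: "local_subring (localize A P) (localize_ideal A P P)"
proof
  show "subring (localize A P)" by (rule subring_localize)
  show "ideal_in (localize A P) (localize_ideal A P P)"
    using prime by (intro ideal_in_localize_ideal prime_in_ideal)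
  show "1 \<notin> localize_ideal A P P"
  proof
    assume "1 \<in> localize_ideal A P P"
    then obtain r s where "r \<in> P" "s \<notin> P" "1 = r / s" by (rule localize_idealE)
    then show False using nonzero by auto
  qed
  fix f assume f: "f \<in> localize A P" "f \<notin> localize_ideal A P P"
  then obtain r s where rs: "r \<in> A" "s \<in> A" "s \<notin> P" "f = r / s" by (blast elim: localizeE)
  then have "r \<notin> P" using f(2) by (auto intro: localize_idealI)
  then show "inverse f \<in> localize A P" using rs by (intro localizeI[of s _ r]) auto
qed

lemma localize_ideal_span2:
  assumes "u \<in> A" "v \<in> A"
  shows "localize_ideal A P (span2 A u v) = span2 (localize A P) u v"
proof
  let ?L = "localize A P"
  show "span2 ?L u v \<subseteq> localize_ideal A P (span2 A u v)"
    using assms localize_ideal_superset span2_left[OF subring_base] span2_right[OF subring_base]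
    by (intro span2_least ideal_in_localize_ideal ideal_in_span2 subring_base) blast+
  show "localize_ideal A P (span2 A u v) \<subseteq> span2 ?L u v"
  proof
    fix f assume "f \<in> localize_ideal A P (span2 A u v)"
    then obtain a b s where f: "a \<in> A" "b \<in> A" "s \<in> A" "s \<notin> P" "f = (a * u + b * v) / s"
      by (auto elim!: localize_idealE span2E)
    then have "f = (a / s) * u + (b / s) * v" by (simp add: add_divide_distrib)
    then show "f \<in> span2 ?L u v" using f by (blast intro: span2I localizeI)
  qed
qed

end

section \<open>Quadratic transforms\<close>

definition quadratic :: "'a::field set \<Rightarrow> 'a \<Rightarrow> 'a \<Rightarrow> 'a set" where
  "quadratic R u v = localize (adjoin R {u / v}) (ideal_gen (adjoin R {u / v}) {v, u / v})"

context regular_parameters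
begin

definition "slope = u / v"
definition "chart = adjoin R {slope}"
definition "centre = span2 chart v slope"

lemma v_slope: "v * slope = u"
  using v_nonzero by (simp add: slope_def)

lemma slope_nonzero: "slope \<noteq> 0"
  using u_nonzero v_nonzero by (simp add: slope_def)

lemma subring_chart: "subring chart"
  by (simp add: chart_def subring_adjoin)

lemmas chart_closed = subring_closed[OF subring_chart]

lemma chart_base: "r \<in> R \<Longrightarrow> r \<in> chart" and slope_chart: "slope \<in> chart"
  by (simp_all add: chart_def adjoin_base adjoin_gen)

lemma ideal_centre: "ideal_in chart centre"
  unfolding centre_def using subring_chart chart_base[OF v] slope_chart by (rule ideal_in_span2)

lemma quadratic_eq: "quadratic R u v = localize chart centre"
  using ideal_gen_pair[OF subring_chart chart_base[OF v] slope_chart]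
  by (simp add: quadratic_def chart_def centre_def slope_def)

lemma chart_expansion:
  assumes "q \<in> chart"
  obtains r q' where "r \<in> R" "q' \<in> chart" "q = r + slope * q'"
proof -
  obtain p where p: "p \<in> polys R" "q = poly p slope"
    using adjoin_singletonE[OF subring] assms unfolding chart_def by blast
  obtain r p' where p': "p = pCons r p'" by (cases p)
  then have "r \<in> R" "p' \<in> polys R" using p(1) by (auto simp: polys_pCons)
  moreover from this have "poly p' slope \<in> chart"
    by (auto simp: chart_def adjoin_singleton[OF subring])
  ultimately show ?thesis using that p(2) p' by simp
qed

lemma chart_clear_denominator:
  assumes "q \<in> chart"
  shows "\<exists>n. v ^ n * q \<in> R"
proof -
  have "\<exists>n. v ^ n * poly p slope \<in> R" if "p \<in> polys R" for p
    using that
  proof (induction p)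
    case 0
    then show ?case using closed(1) by simp
  next
    case (pCons a p)
    then obtain n where n: "a \<in> R" "v ^ n * poly p slope \<in> R" by (auto simp: polys_pCons)
    have "v ^ Suc n * poly (pCons a p) slope = v ^ Suc n * a + (v * slope) * (v ^ n * poly p slope)"
      by (simp add: algebra_simps)
    also have "\<dots> = v ^ Suc n * a + u * (v ^ n * poly p slope)" unfolding v_slope ..
    also have "\<dots> \<in> R"
      by (rule closed(3)[OF closed(5)[OF closed(7)[OF v] n(1)] closed(5)[OF u n(2)]])
    finally show ?case by blast
  qed
  then show ?thesis
    using adjoin_singletonE[OF subring] assms unfolding chart_def by blast
qed

lemma slope_multiples_contraction:
  assumes "r \<in> R" "q \<in> chart" "r = slope * q"
  shows "r \<in> multiples R u"
proof -
  obtain n where n: "v ^ n * q \<in> R" using chart_clear_denominator[OF assms(2)] by blast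
  have "v ^ Suc n * r = v ^ n * q * u" using assms(3) v_slope by (simp add: ac_simps)
  then have "v ^ Suc n * r \<in> multiples R u" using n by (intro multiplesI)
  then show ?thesis
    using regular_parameters.v_prime[OF swap closed(7)[OF v] assms(1)] v_power_notin_u by blast
qed

text \<open>The residue field of the chart at \<^term>\<open>centre\<close> is that of \<^term>\<open>R\<close>.\<close>

lemma in_centre_iff:
  assumes "r \<in> R" "q \<in> chart"
  shows "r + slope * q \<in> centre \<longleftrightarrow> r \<in> span2 R u v"
proof
  assume "r + slope * q \<in> centre"
  then obtain a b where ab: "a \<in> chart" "b \<in> chart" "r + slope * q = a * v + b * slope"
    unfolding centre_def by (rule span2E)
  obtain a0 a1 where a: "a0 \<in> R" "a1 \<in> chart" "a = a0 + slope * a1"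
    using chart_expansion[OF ab(1)] by blast
  have eq: "r - a0 * v = slope * (a1 * v + b - q)" using ab(3) a(3) by (simp add: algebra_simps)
  have "r - a0 * v \<in> multiples R u"
    by (rule slope_multiples_contraction[OF _ _ eq])
      (use a ab assms v chart_base[OF v] in \<open>auto intro: closed chart_closed\<close>)
  then obtain c where "c \<in> R" "r = c * u + a0 * v" by (auto elim!: multiplesE simp: algebra_simps)
  then show "r \<in> span2 R u v" using a by (auto intro: span2I)
next
  assume "r \<in> span2 R u v"
  then obtain a b where ab: "a \<in> R" "b \<in> R" "r = a * u + b * v" by (rule span2E)
  have "b * v + (a * v + q) * slope = a * (v * slope) + b * v + slope * q"
    by (simp add: algebra_simps)
  then have "r + slope * q = b * v + (a * v + q) * slope" using ab(3) by (simp add: v_slope)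
  moreover have "b \<in> chart" "a * v + q \<in> chart"
    using ab assms(2) v by (auto intro: chart_base chart_closed)
  ultimately show "r + slope * q \<in> centre"
    unfolding centre_def by (intro span2I)
qed

lemma prime_centre: "prime_in chart centre"
proof (rule prime_inI[OF subring_chart ideal_centre])
  show "1 \<notin> centre"
    using in_centre_iff[of 1 0] proper closed(2) chart_closed(1) by simp
  fix a b assume ab: "a \<in> chart" "b \<in> chart" "a * b \<in> centre"
  obtain r q where r: "r \<in> R" "q \<in> chart" "a = r + slope * q"
    using chart_expansion[OF ab(1)] by blast
  obtain s p where s: "s \<in> R" "p \<in> chart" "b = s + slope * p"
    using chart_expansion[OF ab(2)] by blast
  have "a * b = r * s + slope * (r * p + q * b)" using r s by (auto simp: algebra_simps)
  moreover have "r * p + q * b \<in> chart"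
    using r(1,2) s(2) ab(2) by (auto intro: chart_closed chart_base)
  ultimately have "r * s \<in> span2 R u v"
    using in_centre_iff[of "r * s"] ab(3) r(1) s(1) by (auto intro: closed)
  then have "r \<in> span2 R u v \<or> s \<in> span2 R u v"
    using prime_in_mult[OF prime_in_max] r s by blast
  then show "a \<in> centre \<or> b \<in> centre" using in_centre_iff r s by auto
qed

sublocale chart: prime_localization chart centre
  using subring_chart prime_centre by unfold_locales

lemma base_subset_quadratic: "R \<subseteq> quadratic R u v"
  using chart_base chart.superset by (auto simp: quadratic_eq)

lemma v_power_notin_slope: "v ^ n \<notin> multiples (quadratic R u v) slope"
proof
  assume "v ^ n \<in> multiples (quadratic R u v) slope"
  then obtain a s where as: "a \<in> chart" "s \<in> chart" "s \<notin> centre" "v ^ n = a / s * slope"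
    unfolding quadratic_eq by (auto elim!: multiplesE localizeE)
  obtain r q where r: "r \<in> R" "q \<in> chart" "s = r + slope * q"
    using chart_expansion[OF as(2)] by blast
  have "r \<in> units R" using in_centre_iff[OF r(1,2)] as(3) r units_eq by simp
  have "s * v ^ n = slope * a" using as(4) chart.nonzero[OF as(3)] by simp
  then have eq: "r * v ^ n = slope * (a - q * v ^ n)" using r(3) by (simp add: algebra_simps)
  have "r * v ^ n \<in> multiples R u"
    by (rule slope_multiples_contraction[OF _ _ eq])
      (use r as(1,2) v chart_base[OF v] in \<open>auto intro: closed chart_closed\<close>)
  then show False
    using regular_parameters.v_prime[OF swap r(1) closed(7)[OF v]] v_power_notin_u
      regular_parameters.unit_notin_v[OF swap \<open>r \<in> units R\<close>] by blast
qed

lemma regular_parameters_quadratic: "regular_parameters (quadratic R u v) v slope"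
proof -
  let ?L = "localize chart centre"
  have "local_subring ?L (span2 ?L v slope)"
    using chart.local_subring_localize chart.localize_ideal_span2[OF chart_base[OF v] slope_chart]
    by (simp add: centre_def)
  moreover have "noetherian ?L"
    using noetherian_adjoin_singleton[OF noeth, of slope]
    by (intro chart.noetherian_localize) (simp add: chart_def)
  moreover have "v \<in> ?L" "slope \<in> ?L" using chart_base[OF v] slope_chart chart.superset by auto
  ultimately show ?thesis
    using slope_nonzero v_power_notin_slope
    unfolding quadratic_eq regular_parameters_def regular_parameters_axioms_def
      two_gen_local_def two_gen_local_axioms_def by blast
qed

lemma quadratic_clear_denominator:
  assumes "f \<in> quadratic R u v"
  obtains n e where "e \<in> units (quadratic R u v)" "v ^ n * e \<in> R" "v ^ n * e * f \<in> R"
proof -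
  obtain a s where as: "a \<in> chart" "s \<in> chart" "s \<notin> centre" "f = a / s"
    using assms unfolding quadratic_eq by (rule localizeE)
  obtain n m where nm: "v ^ n * a \<in> R" "v ^ m * s \<in> R"
    using chart_clear_denominator[OF as(1)] chart_clear_denominator[OF as(2)] by blast
  show ?thesis
  proof (rule that[of s "n + m"])
    show "s \<in> units (quadratic R u v)"
      unfolding quadratic_eq using as(2,3) by (rule chart.unit_localize)
    have "v ^ (n + m) * s = v ^ n * (v ^ m * s)" by (simp add: power_add)
    also have "\<dots> \<in> R" using closed(7)[OF v] nm(2) by (rule closed)
    finally show "v ^ (n + m) * s \<in> R" .
    have "v ^ (n + m) * s * f = v ^ m * (v ^ n * a)"
      using as(4) chart.nonzero[OF as(3)] by (simp add: power_add)
    also have "\<dots> \<in> R" using closed(7)[OF v] nm(1) by (rule closed)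
    finally show "v ^ (n + m) * s * f \<in> R" .
  qed
qed

end

section \<open>Monomials in regular parameters\<close>

definition monomials :: "'a::field set \<Rightarrow> 'a \<Rightarrow> 'a \<Rightarrow> 'a set" where
  "monomials R u v = {u ^ i * v ^ j * e | i j e. e \<in> units R}"

lemma monomialsI: "e \<in> units R \<Longrightarrow> a = u ^ i * v ^ j * e \<Longrightarrow> a \<in> monomials R u v"
  by (auto simp: monomials_def)

lemma monomialsE:
  assumes "a \<in> monomials R u v"
  obtains i j e where "e \<in> units R" "a = u ^ i * v ^ j * e"
  using assms by (auto simp: monomials_def)

context regular_parameters
begin

lemma monomials_divisor:
  assumes ab: "a \<in> R" "b \<in> R" "a * b \<in> monomials R u v"
  shows "a \<in> monomials R u v"
proof -
  obtain i j e where e: "e \<in> units R" "a * b = u ^ i * v ^ j * e"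
    using ab(3) by (rule monomialsE)
  have "v ^ j * e \<in> R" using v unit_mem[OF e(1)] by (intro closed)
  moreover have "a * b = u ^ i * (v ^ j * e)" using e(2) by (simp add: ac_simps)
  ultimately obtain i1 i2 a1 b1
    where a1b1: "a1 \<in> R" "b1 \<in> R" "a = u ^ i1 * a1" "a1 * b1 = v ^ j * e"
    by (rule prime_power_factors[OF subring u_nonzero regular_parameters.prime_v[OF swap] ab(1,2)])
  obtain j1 j2 a2 b2 where a2b2: "a2 \<in> R" "b2 \<in> R" "a1 = v ^ j1 * a2" "a2 * b2 = e"
    by (rule prime_power_factors[OF subring v_nonzero prime_v a1b1(1,2) unit_mem[OF e(1)] a1b1(4)])
  have "a2 \<in> units R" using units_of_mult_eq[OF subring a2b2(1,2) e(1) a2b2(4)] .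
  then show ?thesis
    using a1b1(3) a2b2(3) by (intro monomialsI[of a2 _ _ _ i1 _ j1]) (auto simp: ac_simps)
qed

lemma u_power_unit_notin_v:
  assumes "e \<in> units R"
  shows "u ^ n * e \<notin> multiples R v"
  using v_prime[OF closed(7)[OF u] unit_mem[OF assms]] u_power unit_notin_v[OF assms] by blast

lemma u_exponent_le:
  assumes e: "e \<in> units R" and mem: "d \<in> R" "h \<in> R" and eq: "u ^ a * e + v * d = u ^ b * h"
  shows "b \<le> a"
proof (rule ccontr)
  assume "\<not> b \<le> a"
  then obtain c where c: "b = a + Suc c" using less_imp_Suc_add by (metis add_Suc_right not_le)
  have hu: "u ^ c * h * u \<in> span2 R u v"
    using u mem u_in_max by (intro ideal_in_mult_left[OF ideal] closed)
  have eR: "e - u ^ c * h * u \<in> R" using unit_mem[OF e] ideal_in_mem[OF ideal hu] by (rule closed)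
  have "u ^ a * (e - u ^ c * h * u) = (- d) * v"
    using eq by (simp add: c power_add algebra_simps)
  then have "u ^ a * (e - u ^ c * h * u) \<in> multiples R v"
    using mem by (intro multiplesI[of "- d"] closed)
  then have "e - u ^ c * h * u \<in> multiples R v"
    using v_prime[OF closed(7)[OF u] eR] u_power by blast
  then have "e - u ^ c * h * u \<in> span2 R u v" using multiples_least[OF ideal v_in_max] by blast
  then have "(e - u ^ c * h * u) + u ^ c * h * u \<in> span2 R u v"
    using hu by (rule ideal_in_add[OF ideal])
  then show False using e units_eq by simp
qed

text \<open>Compares the orders along \<^term>\<open>v\<close> and then those along \<^term>\<open>u\<close> modulo \<^term>\<open>v\<close>.\<close>

lemma monomial_exponents_le:
  assumes e: "e \<in> units R" and mem: "d \<in> R" "h \<in> R"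
    and eq: "v ^ j * (u ^ a * e + v * d) = v ^ i * (u ^ b * h)"
  shows "i \<le> j" "b \<le> a"
proof -
  define w where "w = u ^ a * e + v * d"
  have wR: "w \<in> R" unfolding w_def using u v unit_mem[OF e] mem by (intro closed)
  have w_notin: "w \<notin> multiples R v"
  proof
    assume "w \<in> multiples R v"
    then have "w - d * v \<in> multiples R v"
      using mem(1) by (intro ideal_in_diff[OF subring ideal_v]) (auto intro: multiplesI)
    then show False using u_power_unit_notin_v[OF e, of a] by (simp add: w_def mult.commute)
  qed
  show "i \<le> j"
  proof (rule ccontr)
    assume "\<not> i \<le> j"
    then obtain c where c: "i = j + Suc c" using less_imp_Suc_add by (metis add_Suc_right not_le)
    have "v ^ j * w = v ^ j * (v ^ c * (u ^ b * h) * v)"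
      using eq by (simp add: c w_def power_add ac_simps)
    then have "w = v ^ c * (u ^ b * h) * v" using v_nonzero by simp
    moreover have "v ^ c * (u ^ b * h) \<in> R" using u v mem by (intro closed)
    ultimately show False using w_notin by (blast intro: multiplesI)
  qed
  then have "v ^ i * (v ^ (j - i) * w) = v ^ i * (u ^ b * h)"
    using eq by (simp add: w_def flip: power_add mult.assoc)
  then have "u ^ b * h = v ^ (j - i) * w" using v_nonzero by simp
  moreover have "u ^ b \<in> R" using u by (rule closed)
  ultimately obtain n m a' h' where factors: "a' \<in> R" "h' \<in> R" "u ^ b = v ^ n * a'" "a' * h' = w"
    using prime_power_factors[OF subring v_nonzero prime_v _ mem(2) wR] by metis
  have "n = 0"
  proof (rule ccontr)
    assume "n \<noteq> 0"
    then have "u ^ b = v ^ (n - 1) * a' * v" using factors(3) by (cases n) (auto simp: ac_simps)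
    then have "u ^ b \<in> multiples R v"
      using v factors(1) by (intro multiplesI[of "v ^ (n - 1) * a'"] closed)
    then show False using u_power by blast
  qed
  then show "b \<le> a"
    using u_exponent_le[OF e mem(1) factors(2), of a b] factors(3,4) by (simp add: w_def)
qed

end

section \<open>Two successive quadratic transforms\<close>

primrec span2_power :: "'a::field set \<Rightarrow> 'a \<Rightarrow> 'a \<Rightarrow> nat \<Rightarrow> 'a set" where
  "span2_power R x y 0 = R"
| "span2_power R x y (Suc n) =
    {x * a + y * b | a b. a \<in> span2_power R x y n \<and> b \<in> span2_power R x y n}"

lemma span2_power_subset_multiples:
  assumes T: "subring T" "R \<subseteq> T" and xy: "x \<in> multiples T v" "y \<in> multiples T v"
  shows "span2_power R x y n \<subseteq> multiples T (v ^ n)"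
proof (induction n)
  case 0
  then show ?case using T(2) by (auto intro: multiplesI)
next
  case (Suc n)
  obtain x' where x': "x' \<in> T" "x = x' * v" using xy(1) by (rule multiplesE)
  obtain y' where y': "y' \<in> T" "y = y' * v" using xy(2) by (rule multiplesE)
  show ?case
  proof
    fix r assume "r \<in> span2_power R x y (Suc n)"
    then obtain a' b'
      where "a' \<in> multiples T (v ^ n)" "b' \<in> multiples T (v ^ n)" "r = x * a' + y * b'"
      using Suc.IH by auto
    then obtain a b where ab: "a \<in> T" "b \<in> T" "r = x * (a * v ^ n) + y * (b * v ^ n)"
      by (auto elim!: multiplesE)
    then have "r = (x' * a + y' * b) * v ^ Suc n"
      unfolding x'(2) y'(2) by (simp add: algebra_simps)
    moreover have "x' * a + y' * b \<in> T" using ab(1,2) x'(1) y'(1) T(1) by (intro subring_closed)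
    ultimately show "r \<in> multiples T (v ^ Suc n)" by (intro multiplesI)
  qed
qed

locale double_transform = regular_parameters +
  fixes k :: "'a set"
  assumes subfield_k: "subfield k" and k_subset: "k \<subseteq> R"
begin

text \<open>\<^term>\<open>slope\<close> and \<open>z\<close> are local equations of the two exceptional curves, which meet in the
  closed point of \<open>beta\<close>.\<close>

definition "alpha = quadratic R u v"
definition "beta = quadratic alpha v slope"
definition "z = v / slope"

sublocale alpha: regular_parameters alpha v slope
  unfolding alpha_def by (rule regular_parameters_quadratic)

sublocale beta: regular_parameters beta slope z
  using alpha.regular_parameters_quadratic by (simp add: beta_def z_def alpha.slope_def)

lemma slope_z: "slope * z = v"
  using slope_nonzero by (simp add: z_def)

lemma v_power_eq: "v ^ n = slope ^ n * z ^ n"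
  by (simp add: slope_z flip: power_mult_distrib)

lemma base_subset_alpha: "R \<subseteq> alpha"
  unfolding alpha_def by (rule base_subset_quadratic)

lemma alpha_subset_beta: "alpha \<subseteq> beta"
  unfolding beta_def by (rule alpha.base_subset_quadratic)

lemma base_subset_beta: "R \<subseteq> beta"
  using base_subset_alpha alpha_subset_beta by blast

lemma units_alpha_beta: "e \<in> units alpha \<Longrightarrow> e \<in> units beta"
  using units_mono[OF alpha_subset_beta] by blast

lemma subring_k: "subring k"
  using subfield_k by (simp add: subfield_def)

lemma v_multiples_subset_z: "multiples beta v \<subseteq> multiples beta z"
proof (rule multiples_least[OF beta.ideal_v])
  show "v \<in> multiples beta z" using slope_z beta.u by (intro multiplesI[of slope]) auto
qed

lemma z_notin_v: "z \<notin> multiples beta v"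
proof
  assume "z \<in> multiples beta v"
  then obtain b where b: "b \<in> beta" "z = b * v" by (rule multiplesE)
  have "z * (b * slope) = b * (slope * z)" by (simp add: ac_simps)
  also have "\<dots> = z * 1" unfolding slope_z using b(2) by simp
  finally have "b * slope = 1" using beta.v_nonzero by simp
  then show False
    using ideal_in_mult_left[OF beta.ideal b(1) beta.u_in_max] beta.proper by simp
qed

lemma poly_slope_unit:
  assumes Q: "Q \<in> polys k" "poly Q 0 \<noteq> 0"
  shows "poly Q slope \<in> units alpha"
proof -
  obtain c Q' where Q': "Q = pCons c Q'" by (cases Q)
  have ka: "k \<subseteq> alpha" using k_subset base_subset_alpha by blast
  have c: "c \<in> units k" "Q' \<in> polys k"
    using Q units_subfield[OF subfield_k] by (auto simp: Q' polys_pCons)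
  then have "c \<in> units alpha" using units_mono[OF ka] by blast
  moreover have "poly Q' slope * slope \<in> span2 alpha v slope"
    using c(2) polys_mono[OF ka]
    by (intro ideal_in_mult_left[OF alpha.ideal _ alpha.v_in_max]
        poly_mem_subring[OF alpha.subring _ alpha.v]) auto
  ultimately show ?thesis
    using ideal_in_diff[OF alpha.subring alpha.ideal, of "poly Q slope" "poly Q' slope * slope"]
      alpha.units_eq alpha.closed(3) ideal_in_mem[OF alpha.ideal]
    by (auto simp: Q' mult.commute)
qed

lemma poly_slope_factor:
  assumes Q: "Q \<in> polys k" "Q \<noteq> 0"
  obtains e where "e \<in> units beta" "poly Q slope = slope ^ order 0 Q * e"
proof -
  obtain Q1 where Q1: "Q = [:- 0, 1:] ^ order 0 Q * Q1" "poly Q1 0 \<noteq> 0"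
    using order_factor[OF Q(2)] .
  have "Q1 \<in> polys k"
    using polys_divide_linear_power[OF subring_k subring_zero[OF subring_k]] Q(1) Q1(1) by metis
  then have "poly Q1 slope \<in> units beta" using Q1(2) by (intro units_alpha_beta poly_slope_unit)
  moreover have "poly Q slope = slope ^ order 0 Q * poly Q1 slope"
    by (subst Q1(1)) (simp add: poly_power)
  ultimately show ?thesis by (rule that)
qed

lemma poly_slope_nonzero:
  assumes "Q \<in> polys k" "Q \<noteq> 0"
  shows "poly Q slope \<noteq> 0"
proof -
  obtain e where "e \<in> units beta" "poly Q slope = slope ^ order 0 Q * e"
    using poly_slope_factor[OF assms] .
  then show ?thesis using slope_nonzero units_nonzero by auto
qed

lemma form_eq_z_power_mult:
  "v ^ n * (slope ^ a * c + v * d) = z ^ n * (slope ^ (n + a) * c + z * (slope ^ Suc n * d))"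
proof -
  have "(s * w) ^ n * (s ^ a * c + s * w * d) = w ^ n * (s ^ (n + a) * c + w * (s ^ Suc n * d))"
    for s w
    by (simp add: power_mult_distrib power_add algebra_simps)
  from this[of slope z] show ?thesis unfolding slope_z .
qed

lemma initial_form_quotient_orders:
  assumes P: "P \<in> polys k" "P \<noteq> 0" and Q: "Q \<in> polys k" "Q \<noteq> 0" and d: "d \<in> alpha"
    and f: "v ^ j * (poly P slope + v * d) / (v ^ e * poly Q slope) \<in> beta" (is "?f \<in> beta")
  shows "e \<le> j" "e + order 0 Q \<le> j + order 0 P"
proof -
  obtain c where c: "c \<in> units beta" "poly P slope = slope ^ order 0 P * c"
    using poly_slope_factor[OF P] .
  obtain b where b: "b \<in> units beta" "poly Q slope = slope ^ order 0 Q * b"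
    using poly_slope_factor[OF Q] .
  have d': "slope ^ Suc j * d \<in> beta"
    using beta.u alpha_subset_beta d by (auto intro: beta.closed)
  have bf: "b * ?f \<in> beta"
    using units_mem[OF b(1)] f by (rule beta.closed)
  have "v ^ j * (poly P slope + v * d) = v ^ e * poly Q slope * ?f"
    using poly_slope_nonzero[OF Q] v_nonzero by simp
  then have "v ^ j * (slope ^ order 0 P * c + v * d)
      = v ^ e * (slope ^ order 0 Q * (b * ?f) + v * 0)"
    unfolding c(2) b(2) by (simp only: mult.assoc mult_zero_right add_0_right)
  then have "z ^ j * (slope ^ (j + order 0 P) * c + z * (slope ^ Suc j * d))
      = z ^ e * (slope ^ (e + order 0 Q) * (b * ?f))"
    unfolding form_eq_z_power_mult by simp
  then show "e \<le> j" "e + order 0 Q \<le> j + order 0 P"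
    by (rule beta.monomial_exponents_le[OF c(1) d' bf])+
qed

lemma initial_form_quotient_unit:
  assumes Q: "Q \<in> polys k" "Q \<noteq> 0" and d: "d \<in> alpha"
    and q: "v ^ n * (poly Q slope + v * d) \<in> monomials beta slope z"
  shows "v ^ n * (poly Q slope + v * d) / (v ^ n * poly Q slope) \<in> units beta"
proof -
  obtain i j e where e: "e \<in> units beta" "v ^ n * (poly Q slope + v * d) = slope ^ i * z ^ j * e"
    using q by (rule monomialsE)
  obtain c where c: "c \<in> units beta" "poly Q slope = slope ^ order 0 Q * c"
    using poly_slope_factor[OF Q] .
  define a where "a = n + order 0 Q"
  define b where "b = slope ^ Suc n * d"
  have mem: "b \<in> beta" "e \<in> beta" "c \<in> beta"
    unfolding b_def
    using beta.u subsetD[OF alpha_subset_beta d] units_mem[OF c(1)] units_mem[OF e(1)]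
    by (auto intro: beta.closed)
  have form_mem: "slope ^ a * c + z * b \<in> beta" using mem beta.u beta.v by (intro beta.closed)
  have eq: "z ^ n * (slope ^ a * c + z * b) = z ^ j * (slope ^ i * e)"
    using e(2) unfolding c(2) form_eq_z_power_mult a_def b_def by (simp add: ac_simps)
  have "j \<le> n" "i \<le> a" using beta.monomial_exponents_le[OF c(1) mem(1,2) eq] .
  moreover have "z ^ j * (slope ^ i * e + z * 0) = z ^ n * (slope ^ 0 * (slope ^ a * c + z * b))"
    using eq by simp
  then have "n \<le> j" by (rule beta.monomial_exponents_le(1)[OF e(1) beta.closed(1) form_mem])
  ultimately have "n = j" by simp
  then have "slope ^ a * c + z * b = slope ^ i * e" using eq beta.v_nonzero by simp
  then have "slope ^ i * e + z * (- b) = slope ^ a * c" by (simp add: algebra_simps)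
  then have "a \<le> i" by (rule beta.u_exponent_le[OF e(1) beta.closed(6)[OF mem(1)] mem(3)])
  then have "i = a" using \<open>i \<le> a\<close> by simp
  have "v ^ n * poly Q slope = z ^ n * (slope ^ a * c)"
    unfolding c(2) a_def using form_eq_z_power_mult[of n "order 0 Q" c 0] by simp
  then have "v ^ n * (poly Q slope + v * d) / (v ^ n * poly Q slope)
      = slope ^ i * z ^ j * e / (z ^ n * (slope ^ a * c))"
    using e(2) by simp
  also have "\<dots> = e / c"
    using beta.v_nonzero slope_nonzero by (simp add: \<open>n = j\<close> \<open>i = a\<close>)
  finally show ?thesis using units_divide[OF beta.subring e(1) c(1)] by simp
qed

lemma monomial_denominator:
  assumes "f \<in> beta"
  obtains c where "c \<in> R" "c * f \<in> R" "c \<in> monomials beta slope z"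
proof -
  obtain n e where e: "e \<in> units beta" "slope ^ n * e \<in> alpha" "slope ^ n * e * f \<in> alpha"
    using assms alpha.quadratic_clear_denominator unfolding beta_def by blast
  obtain m d where d: "d \<in> units alpha" "v ^ m * d \<in> R" "v ^ m * d * (slope ^ n * e) \<in> R"
    using e(2) quadratic_clear_denominator unfolding alpha_def by blast
  obtain l b where b: "b \<in> units alpha" "v ^ l * b \<in> R" "v ^ l * b * (slope ^ n * e * f) \<in> R"
    using e(3) quadratic_clear_denominator unfolding alpha_def by blast
  define c where "c = v ^ l * b * (v ^ m * d * (slope ^ n * e))"
  have "c = v ^ (l + m) * (slope ^ n * (b * (d * e)))"
    by (simp add: c_def power_add ac_simps)
  also have "\<dots> = slope ^ (l + m + n) * z ^ (l + m) * (b * (d * e))"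
    unfolding v_power_eq[of "l + m"] by (simp add: power_add ac_simps)
  finally have "c = slope ^ (l + m + n) * z ^ (l + m) * (b * (d * e))" .
  moreover have "b * (d * e) \<in> units beta"
    using units_alpha_beta[OF b(1)] units_alpha_beta[OF d(1)] e(1) beta.subring
    by (intro units_mult)
  ultimately have "c \<in> monomials beta slope z" by (rule monomialsI[rotated])
  moreover have "c * f = v ^ m * d * (v ^ l * b * (slope ^ n * e * f))"
    by (simp add: c_def ac_simps)
  then have "c * f \<in> R" using closed(5)[OF d(2) b(3)] by (simp only:)
  moreover have "c \<in> R" unfolding c_def using b(2) d(3) by (rule closed)
  ultimately show ?thesis using that by blast
qed

lemma reduced_denominator_monomial:
  assumes "f \<in> beta" "d \<in> R" "{s\<in>R. s * f \<in> R} \<subseteq> multiples R d"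
  shows "d \<in> monomials beta slope z"
proof -
  obtain c where c: "c \<in> R" "c * f \<in> R" "c \<in> monomials beta slope z"
    using monomial_denominator[OF assms(1)] .
  then obtain b where "b \<in> R" "c = d * b"
    using assms(3) by (auto elim!: multiplesE simp: mult.commute)
  then show ?thesis
    using beta.monomials_divisor[of d b] c(3) assms(2) base_subset_beta by blast
qed

lemma span2_power_separated:
  assumes xy: "x \<in> multiples alpha v" "y \<in> multiples alpha v" and q: "q \<in> R" "q \<noteq> 0"
  shows "\<exists>n. q \<notin> span2_power R x y n"
proof -
  obtain n s where s: "s \<in> alpha" "s \<notin> multiples alpha v" "q = v ^ n * s"
    using regular_parameters.v_adic_expansion[OF alpha.swap, of q] q base_subset_alpha by blast
  have "q \<notin> multiples alpha (v ^ Suc n)"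
  proof
    assume "q \<in> multiples alpha (v ^ Suc n)"
    then obtain a where "a \<in> alpha" "q = a * v ^ Suc n" by (rule multiplesE)
    then have "s = a * v" using s(3) v_nonzero by (simp add: ac_simps)
    then show False using s(2) \<open>a \<in> alpha\<close> by (blast intro: multiplesI)
  qed
  then show ?thesis
    using span2_power_subset_multiples[OF alpha.subring base_subset_alpha xy] by blast
qed

end

section \<open>Partial fractions\<close>

lemma order_mult_linear:
  fixes p :: "'a::field poly"
  assumes "p \<noteq> 0"
  shows "order b ([:- a, 1:] * p) = order b p + (if a = b then 1 else 0)"
proof -
  have "order b [:- a, 1:] = (if a = b then 1 else 0)"
    using order_power_n_n[of a 1] by (auto intro: order_0I)
  moreover have "[:- a, 1:] * p \<noteq> 0" using assms by (simp del: mult_pCons_left)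
  ultimately show ?thesis by (simp add: order_mult del: mult_pCons_left)
qed

lemma order_mult_linear_power:
  fixes p :: "'a::field poly"
  assumes "p \<noteq> 0" "a \<noteq> b"
  shows "order b ([:- a, 1:] ^ n * p) = order b p"
proof -
  have "order b ([:- a, 1:] ^ n) = 0" using assms(2) by (intro order_0I) (simp add: poly_power)
  then show ?thesis using assms(1) by (simp add: order_mult)
qed

lemma order_diff_smult_ge:
  fixes p q :: "'a::field poly"
  assumes "p - smult c q \<noteq> 0" "n \<le> order a p" "n \<le> order a q"
  shows "n \<le> order a (p - smult c q)"
proof -
  have "[:- a, 1:] ^ n dvd p - smult c q"
    using assms(2,3) by (intro dvd_diff dvd_smult) (auto simp: order_divides)
  then show ?thesis using assms(1) by (simp add: order_divides)
qed

text \<open>The fraction \<^term>\<open>P / Q\<close> has poles of order at most \<^term>\<open>r\<close> at the points of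
  \<^term>\<open>k\<close> and at most \<^term>\<open>2 * r\<close> at infinity.\<close>

definition bounded_poles :: "'a::field set \<Rightarrow> nat \<Rightarrow> 'a poly \<Rightarrow> 'a poly \<Rightarrow> bool" where
  "bounded_poles k r P Q \<longleftrightarrow> P = 0 \<or>
     (\<forall>c\<in>k. order c Q \<le> order c P + r) \<and> degree P \<le> degree Q + 2 * r"

lemma bounded_polesD:
  assumes "bounded_poles k r P Q" "P \<noteq> 0"
  shows "c \<in> k \<Longrightarrow> order c Q \<le> order c P + r" "degree P \<le> degree Q + 2 * r"
  using assms by (auto simp: bounded_poles_def)

lemma degree_divide_linear_le:
  fixes P Q :: "'a::field poly"
  assumes P2: "P - smult \<mu> Q1 = [:- c, 1:] * P2" "P2 \<noteq> 0"
    and Q: "Q = [:- c, 1:] * Q2" "Q \<noteq> 0" "Q1 dvd Q" and deg: "degree P \<le> degree Q + n"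
  shows "degree P2 \<le> degree Q2 + n"
proof -
  have "Q2 \<noteq> 0" using Q by auto
  then have "degree Q = Suc (degree Q2)" unfolding Q(1) by (subst degree_mult_eq) auto
  moreover have "Suc (degree P2) = degree (P - smult \<mu> Q1)"
    unfolding P2(1) using P2(2) by (subst degree_mult_eq) auto
  moreover have "degree Q1 \<le> degree Q" using Q(2,3) by (simp add: dvd_imp_degree_le)
  then have "degree (P - smult \<mu> Q1) \<le> degree Q + n"
    using deg degree_smult_le[of \<mu> Q1] by (intro degree_diff_le) auto
  ultimately show ?thesis by simp
qed

lemma bounded_poles_divide:
  fixes P Q :: "'a::field poly"
  assumes PQ: "bounded_poles k r P Q" "Q \<noteq> 0"
    and c: "c \<in> k" "poly P c = \<mu> * poly Q1 c" "poly Q1 c \<noteq> 0"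
    and Q: "Q = [:- c, 1:] * Q2" "Q = [:- c, 1:] ^ order c Q * Q1"
    and P2: "P - smult \<mu> Q1 = [:- c, 1:] * P2"
  shows "bounded_poles k r P2 Q2"
proof (cases "P2 = 0")
  case False
  have nz: "Q2 \<noteq> 0" "Q1 \<noteq> 0" "[:- c, 1:] * P2 \<noteq> 0"
    using PQ(2) Q False by (auto simp del: mult_pCons_left)
  have "P \<noteq> 0" using c P2 nz(3) by (auto simp del: mult_pCons_left)
  note P_bound = bounded_polesD[OF PQ(1) this]
  have "order b Q2 \<le> order b P2 + r" if b: "b \<in> k" for b
  proof (cases "b = c")
    case True
    have "order c Q = Suc (order c Q2)"
      using order_mult_linear[OF nz(1), of c c] by (simp add: Q(1))
    moreover have "order c P \<le> Suc (order c P2)"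
    proof (cases "poly P c = 0")
      case True
      then have "P = [:- c, 1:] * P2" using c P2 by simp
      then show ?thesis using order_mult_linear[OF False, of c c] by simp
    qed (simp add: order_0I)
    ultimately show ?thesis using P_bound(1)[OF b] True by simp
  next
    case neq: False
    have "order b Q = order b Q1" using order_mult_linear_power[OF nz(2)] Q(2) neq by metis
    then have "order b Q - r \<le> order b (P - smult \<mu> Q1)"
      using nz(3) P_bound(1)[OF b] unfolding P2[symmetric]
      by (intro order_diff_smult_ge) auto
    moreover have "order b (P - smult \<mu> Q1) = order b P2" "order b Q = order b Q2"
      unfolding P2 Q(1)
      using order_mult_linear[OF False, of b c] order_mult_linear[OF nz(1), of b c] neq
      by simp_all
    ultimately show ?thesis by simp
  qed
  moreover have "Q1 dvd Q" using Q(2) by (metis dvd_triv_right)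
  then have "degree P2 \<le> degree Q2 + 2 * r"
    by (rule degree_divide_linear_le[OF P2 False Q(1) PQ(2) _ P_bound(2)])
  ultimately show ?thesis by (simp add: bounded_poles_def)
qed (simp add: bounded_poles_def)

lemma partial_fraction_identity:
  fixes P Q :: "'a::field poly"
  assumes Q: "Q = [:- c, 1:] * Q2" "Q = [:- c, 1:] ^ l * Q1"
    and P: "P - smult \<mu> Q1 = [:- c, 1:] * P2" and t: "poly Q t \<noteq> 0"
  shows "poly P t / poly Q t = poly P2 t / poly Q2 t + \<mu> / (t - c) ^ l"
proof -
  have Q_t: "poly Q t = (t - c) * poly Q2 t" "poly Q t = (t - c) ^ l * poly Q1 t"
    using arg_cong[OF Q(1), of "\<lambda>p. poly p t"] arg_cong[OF Q(2), of "\<lambda>p. poly p t"]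
    by (simp_all add: poly_power algebra_simps)
  have "poly P t = (t - c) * poly P2 t + \<mu> * poly Q1 t"
    using arg_cong[OF P, of "\<lambda>p. poly p t"] by (simp add: algebra_simps)
  then have "poly P t / poly Q t = (t - c) * poly P2 t / poly Q t + \<mu> * poly Q1 t / poly Q t"
    by (simp add: add_divide_distrib)
  also have "(t - c) * poly P2 t / poly Q t = poly P2 t / poly Q2 t"
    using t unfolding Q_t(1) by simp
  also have "\<mu> * poly Q1 t / poly Q t = \<mu> / (t - c) ^ l"
    using t unfolding Q_t(2) by simp
  finally show ?thesis .
qed

lemma partial_fraction_step:
  assumes k: "subfield k" "c \<in> k" and P: "P \<in> polys k" and Q: "Q \<in> polys k" "Q \<noteq> 0"
    and poles: "bounded_poles k r P Q" and root: "poly Q c = 0"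
  obtains P2 Q2 \<mu> where "P2 \<in> polys k" "Q2 \<in> polys k" "Q2 \<noteq> 0" "degree Q = Suc (degree Q2)"
    "bounded_poles k r P2 Q2" "\<mu> \<in> k" "\<mu> = 0 \<or> order c Q \<le> r"
    "\<And>t. poly Q t \<noteq> 0 \<Longrightarrow> poly P t / poly Q t = poly P2 t / poly Q2 t + \<mu> / (t - c) ^ order c Q"
proof -
  have subring_k: "subring k" using k(1) by (simp add: subfield_def)
  obtain Q2 where Q2: "Q = [:- c, 1:] * Q2" using root unfolding poly_eq_0_iff_dvd by (rule dvdE)
  obtain Q1 where Q1: "Q = [:- c, 1:] ^ order c Q * Q1" "poly Q1 c \<noteq> 0"
    using order_factor[OF Q(2)] .
  have Q20: "Q2 \<noteq> 0" using Q(2) Q2 by auto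
  have polys_Q: "Q1 \<in> polys k" "Q2 \<in> polys k"
    using polys_divide_linear_power[OF subring_k k(2)] polys_divide_linear[OF subring_k k(2)]
      Q(1) Q1(1) Q2
    by metis+
  define \<mu> where "\<mu> = poly P c / poly Q1 c"
  have P_c: "poly P c = \<mu> * poly Q1 c" using Q1(2) by (simp add: \<mu>_def)
  then have "poly (P - smult \<mu> Q1) c = 0" by simp
  then obtain P2 where P2: "P - smult \<mu> Q1 = [:- c, 1:] * P2"
    unfolding poly_eq_0_iff_dvd by (rule dvdE)
  have "poly P c \<in> k" "poly Q1 c \<in> k"
    using P polys_Q(1) k(2) by (auto intro: poly_mem_subring[OF subring_k])
  then have \<mu>: "\<mu> \<in> k"
    using k(1) Q1(2) subring_mult[OF subring_k] by (simp add: \<mu>_def divide_inverse subfield_def)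
  show ?thesis
  proof (rule that[OF _ polys_Q(2) Q20 _ _ \<mu>])
    have "P - smult \<mu> Q1 \<in> polys k"
      using P polys_Q(1) \<mu> by (intro polys_diff polys_smult subring_k)
    then show "P2 \<in> polys k" unfolding P2 by (rule polys_divide_linear[OF subring_k k(2)])
    show "degree Q = Suc (degree Q2)" using Q20 unfolding Q2 by (subst degree_mult_eq) auto
    show "bounded_poles k r P2 Q2"
      by (rule bounded_poles_divide[OF poles Q(2) k(2) P_c Q1(2) Q2 Q1(1) P2])
    show "\<mu> = 0 \<or> order c Q \<le> r"
    proof (rule disjCI)
      assume "\<not> order c Q \<le> r"
      then have "P = 0 \<or> order c P \<noteq> 0" using bounded_polesD(1)[OF poles _ k(2)] by (metis add_0)
      then show "\<mu> = 0" using order_0I[of P c] by (metis P_c Q1(2) mult_eq_0_iff poly_0)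
    qed
    show "poly P t / poly Q t = poly P2 t / poly Q2 t + \<mu> / (t - c) ^ order c Q"
      if "poly Q t \<noteq> 0" for t
      using Q2 Q1(1) P2 that by (rule partial_fraction_identity)
  qed
qed

lemma power_product_mem:
  assumes A: "subring A" and gens: "y \<in> A" "y * t \<in> A" "y * t\<^sup>2 \<in> A"
  shows "i \<le> 2 * r \<Longrightarrow> y ^ r * t ^ i \<in> A"
proof (induction r arbitrary: i)
  case 0
  then show ?case using A by (simp add: subring_one)
next
  case (Suc r)
  consider "i \<le> 2 * r" | "i = Suc (2 * r)" | "i = Suc (Suc (2 * r))" using Suc.prems by fastforce
  then show ?case
  proof cases
    case 1
    have "y * (y ^ r * t ^ i) \<in> A" by (rule subring_mult[OF A gens(1) Suc.IH[OF 1]])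
    then show ?thesis by (simp add: ac_simps)
  next
    case 2
    have "(y * t) * (y ^ r * t ^ (2 * r)) \<in> A" by (rule subring_mult[OF A gens(2) Suc.IH]) simp
    then show ?thesis by (simp add: 2 ac_simps)
  next
    case 3
    have "(y * t\<^sup>2) * (y ^ r * t ^ (2 * r)) \<in> A" by (rule subring_mult[OF A gens(3) Suc.IH]) simp
    then show ?thesis by (simp add: 3 power2_eq_square ac_simps)
  qed
qed

lemma power_times_poly_mem:
  assumes A: "subring A" and gens: "y \<in> A" "y * t \<in> A" "y * t\<^sup>2 \<in> A"
    and P: "P \<in> polys A" "degree P \<le> 2 * r"
  shows "y ^ r * poly P t \<in> A"
proof -
  have "y ^ r * poly P t = (\<Sum>i\<le>degree P. coeff P i * (y ^ r * t ^ i))"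
    by (simp add: poly_altdef sum_distrib_left ac_simps)
  also have "\<dots> \<in> A"
    using P
    by (intro subring_sum[OF A] subring_mult[OF A polys_coeff power_product_mem[OF A gens]]) auto
  finally show ?thesis .
qed

lemma pole_term_mem:
  assumes A: "subring A" and gens: "y \<in> A" "y / s \<in> A" and "l \<le> r"
  shows "y ^ r / s ^ l \<in> A"
proof -
  have "y ^ r / s ^ l = y ^ (r - l) * (y / s) ^ l"
    using \<open>l \<le> r\<close> by (simp add: power_divide flip: power_add)
  also have "\<dots> \<in> A" using A gens by (intro subring_mult subring_power)
  finally show ?thesis .
qed

lemma partial_fractions:
  fixes A k :: "'a::field set"
  assumes A: "subring A" and k: "alg_closed_subfield k" "k \<subseteq> A"
    and trans: "\<And>Q. Q \<in> polys k \<Longrightarrow> Q \<noteq> 0 \<Longrightarrow> poly Q t \<noteq> 0"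
    and gens: "y \<in> A" "y * t \<in> A" "y * t\<^sup>2 \<in> A" "\<And>c. c \<in> k \<Longrightarrow> y / (t - c) \<in> A"
    and P: "P \<in> polys k" and Q: "Q \<in> polys k" "Q \<noteq> 0" and poles: "bounded_poles k r P Q"
  shows "y ^ r * poly P t / poly Q t \<in> A"
  using P Q poles
proof (induction "degree Q" arbitrary: P Q)
  case 0
  obtain q where q: "Q = [:q:]" using 0(1) by (metis degree_eq_zeroE)
  have "subfield k" using k(1) by (simp add: alg_closed_subfield_def)
  then have "inverse q \<in> A"
    using 0(3,4) k(2) by (auto simp: q polys_pCons subfield_def)
  moreover have "degree P \<le> 2 * r"
    using bounded_polesD(2)[OF 0(5)] by (cases "P = 0") (auto simp: q)
  then have "y ^ r * poly P t \<in> A"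
    using 0(2) polys_mono[OF k(2)] by (intro power_times_poly_mem[OF A gens(1-3)]) auto
  ultimately show ?case using subring_mult[OF A] by (simp add: q divide_inverse)
next
  case (Suc d)
  obtain c where c: "c \<in> k" "poly Q c = 0"
    using k(1) Suc.prems(2) Suc.hyps(2) unfolding alg_closed_subfield_def polys_def by force
  have "subfield k" using k(1) by (simp add: alg_closed_subfield_def)
  then obtain P2 Q2 \<mu> where step: "P2 \<in> polys k" "Q2 \<in> polys k" "Q2 \<noteq> 0"
    "degree Q = Suc (degree Q2)" "bounded_poles k r P2 Q2" "\<mu> \<in> k" "\<mu> = 0 \<or> order c Q \<le> r"
    "poly Q t \<noteq> 0 \<Longrightarrow> poly P t / poly Q t = poly P2 t / poly Q2 t + \<mu> / (t - c) ^ order c Q"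
    using partial_fraction_step[OF _ c(1) Suc.prems c(2)] by metis
  have "y ^ r * poly P2 t / poly Q2 t \<in> A"
    using Suc.hyps(2) step(4) by (intro Suc.hyps(1)[OF _ step(1-3,5)]) simp
  moreover have "\<mu> * (y ^ r / (t - c) ^ order c Q) \<in> A"
  proof (cases "\<mu> = 0")
    case False
    then have "order c Q \<le> r" using step(7) by blast
    then show ?thesis
      using pole_term_mem[OF A gens(1) gens(4)[OF c(1)]] subring_mult[OF A] step(6) k(2) by blast
  qed (simp add: subring_zero[OF A])
  moreover have "y ^ r * (poly P t / poly Q t)
      = y ^ r * poly P2 t / poly Q2 t + \<mu> * (y ^ r / (t - c) ^ order c Q)"
    unfolding step(8)[OF trans[OF Suc.prems(2,3)]] by (simp add: distrib_left)
  ultimately show ?case using subring_add[OF A] by simp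
qed

section \<open>Binary forms as univariate polynomials\<close>

text \<open>The polynomial \<^term>\<open>P\<close> stands for the form \<open>y\<^sup>j P(x / y)\<close> of degree \<^term>\<open>j\<close>. A point \<open>p\<close>
  of the projective line, with \<^term>\<open>None\<close> at infinity, determines the coordinates \<open>(y, x)\<close> or
  \<open>(x + a y, y)\<close>, in which the same form is given by \<open>form_at p j P\<close>.\<close>

fun form_at :: "'a::field option \<Rightarrow> nat \<Rightarrow> 'a poly \<Rightarrow> 'a poly" where
  "form_at None j P = monom 1 (j - degree P) * reflect_poly P"
| "form_at (Some a) j P = pcompose P [:- a, 1:]"

lemma form_at_eq_0_iff [simp]: "form_at p j P = 0 \<longleftrightarrow> P = 0"
  by (cases p) (simp_all add: pcompose_eq_0_iff)

lemma polys_form_at: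
  assumes k: "subring k" and p: "\<And>a. p = Some a \<Longrightarrow> a \<in> k" and P: "P \<in> polys k"
  shows "form_at p j P \<in> polys k"
proof (cases p)
  case None
  have "reflect_poly P \<in> polys k"
    using P k by (auto simp: polys_def coeff_reflect_poly subring_zero)
  then show ?thesis using None k by (simp add: polys_mult polys_monom subring_one)
next
  case (Some a)
  then show ?thesis
    using p P k by (auto intro!: polys_pcompose polys_linear simp: subring_one subring_uminus)
qed

lemma order_form_at_None: "P \<noteq> 0 \<Longrightarrow> order 0 (form_at None j P) = j - degree P"
  by (simp add: order_mult order_0I)

lemma order_form_at_Some:
  assumes "P \<noteq> 0"
  shows "order 0 (form_at (Some a) j P) = order (- a) P"
proof -
  obtain H where H: "P = [:a, 1:] ^ order (- a) P * H" "poly H (- a) \<noteq> 0"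
    using order_factor[OF assms, of "- a"] by auto
  have "pcompose ([:a, 1:] ^ n) [:- a, 1:] = monom 1 n" for n
    using pcompose_prod[of "\<lambda>_. [:a, 1:]" "{..<n}" "[:- a, 1:]"]
    by (simp add: pcompose_pCons monom_altdef)
  then have "pcompose P [:- a, 1:] = monom 1 (order (- a) P) * pcompose H [:- a, 1:]"
    by (subst H(1)) (simp add: pcompose_mult)
  moreover have "order 0 (pcompose H [:- a, 1:]) = 0"
    using H(2) by (intro order_0I) (simp add: poly_pcompose)
  moreover have "pcompose P [:- a, 1:] \<noteq> 0" using assms by (simp add: pcompose_eq_0_iff)
  ultimately show ?thesis by (simp add: order_mult)
qed

lemma poly_form_at_None:
  assumes "degree P \<le> j" "x \<noteq> 0" "y \<noteq> 0"
  shows "y ^ j * poly P (x / y) = x ^ j * poly (form_at None j P) (y / x)"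
proof -
  have "poly (form_at None j P) (y / x)
      = (y / x) ^ (j - degree P) * (y / x) ^ degree P * poly P (x / y)"
    using assms by (simp add: poly_monom poly_reflect_poly_nz)
  also have "\<dots> = (y / x) ^ j * poly P (x / y)" using assms(1) by (simp flip: power_add)
  finally show ?thesis using assms(2) by (simp add: power_divide)
qed

lemma poly_form_at_Some:
  "y \<noteq> 0 \<Longrightarrow> y ^ j * poly P (x / y) = y ^ j * poly (form_at (Some a) j P) ((x + a * y) / y)"
  by (simp add: poly_pcompose add_divide_distrib)

lemma bounded_poles_if_order_form_at:
  assumes nonzero: "P \<noteq> 0" "Q \<noteq> 0" and deg: "degree P \<le> j" "degree Q \<le> e" and "e \<le> j"
    and k: "subring k"
    and ord: "\<And>p. p \<in> insert None (Some ` k) \<Longrightarrow>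
      e + order 0 (form_at p e Q) \<le> j + order 0 (form_at p j P)"
  shows "bounded_poles k (j - e) P Q"
proof -
  have "order c Q \<le> order c P + (j - e)" if "c \<in> k" for c
    using ord[of "Some (- c)"] that k \<open>e \<le> j\<close> nonzero
    by (simp add: order_form_at_Some subring_uminus del: form_at.simps)
  moreover have "degree P \<le> degree Q + 2 * (j - e)"
    using ord[of None] deg \<open>e \<le> j\<close> nonzero by (simp add: order_form_at_None del: form_at.simps)
  ultimately show ?thesis by (simp add: bounded_poles_def)
qed

lemma infinite_alg_closed_subfield:
  assumes "alg_closed_subfield k"
  shows "infinite k"
proof
  assume fin: "finite k"
  have k: "subring k" using assms by (simp add: alg_closed_subfield_def subfield_def)
  define p where "p = (\<Prod>c\<in>k. [:- c, 1:])"
  have "(\<Prod>c\<in>K. [:- c, 1:]) \<in> polys k" if "K \<subseteq> k" for K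
    using finite_subset[OF that fin] that
    by (induction K rule: finite_induct)
      (auto intro!: polys_mult[OF k] polys_one[OF k] polys_linear[OF k]
        simp: subring_one[OF k] subring_uminus[OF k] simp del: mult_pCons_left)
  then have "p + 1 \<in> polys k" unfolding p_def by (intro polys_add[OF k] polys_one[OF k]) auto
  moreover have "degree p = card k" unfolding p_def by (subst degree_prod_eq_sum_degree) auto
  then have "degree p > 0" using fin subring_zero[OF k] by (auto simp: card_gt_0_iff)
  then have "degree (p + 1) > 0" by (simp add: degree_add_eq_left)
  ultimately obtain c where c: "c \<in> k" "poly (p + 1) c = 0"
    using assms unfolding alg_closed_subfield_def polys_def by blast
  have "poly p c = 0" unfolding p_def poly_prod using fin c(1) by (auto intro!: bexI[of _ c])
  then show False using c by simp
qed

section \<open>The transforms at the points of the projective line\<close>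

locale regular_over_alg_closed =
  fixes D k :: "'a::field set" and x y :: 'a
  assumes regular_D: "regular_local2 D"
    and quotient_field: "quotient_field_is_univ D"
    and x: "x \<in> D" and y: "y \<in> D"
    and max_D: "max_ideal D = ideal_gen D {x, y}"
    and coeff_field: "coefficient_field D k"
    and alg_closed: "alg_closed_subfield k"
begin

definition "points = insert None (Some ` k)"

definition num :: "'a option \<Rightarrow> 'a" where
  "num p = (case p of None \<Rightarrow> y | Some a \<Rightarrow> x + a * y)"

definition den :: "'a option \<Rightarrow> 'a" where
  "den p = (case p of None \<Rightarrow> x | Some a \<Rightarrow> y)"

definition "gen p = (den p)\<^sup>2 / num p"

lemma num_simps [simp]: "num None = y" "num (Some a) = x + a * y"
  and den_simps [simp]: "den None = x" "den (Some a) = y"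
  by (simp_all add: num_def den_def)

lemma pointsE:
  assumes "p \<in> points"
  obtains "p = None" | a where "a \<in> k" "p = Some a"
  using assms by (auto simp: points_def)

lemma None_in_points: "None \<in> points"
  by (simp add: points_def)

lemma infinite_points: "infinite points"
  using infinite_alg_closed_subfield[OF alg_closed] by (simp add: points_def finite_image_iff)

lemma subring_D: "subring D"
  using regular_D noetherian_subring by (auto simp: regular_local2_def)

lemma subfield_k: "subfield k" and k_subset_D: "k \<subseteq> D"
  using coeff_field by (auto simp: coefficient_field_def)

lemma subring_k: "subring k"
  using subfield_k by (simp add: subfield_def)

lemma max_D_eq: "max_ideal D = span2 D x y"
  using max_D ideal_gen_pair[OF subring_D x y] by simp

lemma double_transform_point:
  assumes "p \<in> points"
  shows "double_transform D (num p) (den p) k"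
proof -
  have mem: "num p \<in> D" "den p \<in> D"
    using assms x y k_subset_D by (auto elim!: pointsE intro!: subring_closed[OF subring_D])
  have "span2 D (num p) (den p) = span2 D x y"
    using assms
  proof (cases rule: pointsE)
    case 1
    then show ?thesis by (simp add: span2_commute)
  next
    case (2 a)
    then show ?thesis using span2_shear[OF subring_D] k_subset_D by auto
  qed
  then have "max_ideal D = ideal_gen D {num p, den p}"
    using max_D_eq ideal_gen_pair[OF subring_D mem] by simp
  then have "regular_parameters D (num p) (den p)"
    by (rule regular_parameters_of_regular_local2[OF regular_D mem])
  then show ?thesis
    using subfield_k k_subset_D by (simp add: double_transform_def double_transform_axioms_def)
qed

lemma regular_parameters_point: "p \<in> points \<Longrightarrow> regular_parameters D (num p) (den p)"
  using double_transform_point by (simp add: double_transform_def)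

lemma num_nonzero: "p \<in> points \<Longrightarrow> num p \<noteq> 0" and den_nonzero: "p \<in> points \<Longrightarrow> den p \<noteq> 0"
  using regular_parameters.u_nonzero[OF regular_parameters_point]
    regular_parameters.v_nonzero[OF regular_parameters_point] by auto

lemma x_nonzero: "x \<noteq> 0" and y_nonzero: "y \<noteq> 0"
  using num_nonzero[OF None_in_points] den_nonzero[OF None_in_points] by simp_all

abbreviation "alpha_at p \<equiv> double_transform.alpha D (num p) (den p)"
abbreviation "beta_at p \<equiv> double_transform.beta D (num p) (den p)"
abbreviation "z_at p \<equiv> double_transform.z (num p) (den p)"

definition "G = gen ` points"
definition "A = adjoin D G"
definition "m = ideal_gen A ({x, y} \<union> G)"
definition "C = localize A m"
definition "T = (\<Inter>p\<in>points. beta_at p)"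

lemma subring_A: "subring A"
  by (simp add: A_def subring_adjoin)

lemma D_subset_A: "D \<subseteq> A" and gen_in_A: "p \<in> points \<Longrightarrow> gen p \<in> A"
  by (auto simp: A_def G_def intro: adjoin_base adjoin_gen)

lemma k_subset_A: "k \<subseteq> A"
  using k_subset_D D_subset_A by blast

lemma gens_subset_A: "{x, y} \<union> G \<subseteq> A"
  using x y D_subset_A gen_in_A by (auto simp: G_def)

lemma ideal_m: "ideal_in A m"
  unfolding m_def using subring_A gens_subset_A by (rule ideal_in_ideal_gen)

lemma gens_subset_m: "{x, y} \<union> G \<subseteq> m"
  unfolding m_def by (rule ideal_gen_superset)

lemma coordinates_in_multiples_den:
  assumes "p \<in> points" "w \<in> {x, y}"
  shows "w \<in> multiples (alpha_at p) (den p)"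
proof -
  interpret double_transform D "num p" "den p" k using assms(1) by (rule double_transform_point)
  have den: "den p \<in> multiples alpha (den p)" using alpha.subring by (rule multiples_self)
  have slope: "num p / den p \<in> alpha" using alpha.v by (simp add: slope_def)
  show ?thesis
    using assms(1)
  proof (cases rule: pointsE)
    case 1
    then have "y \<in> multiples alpha (den p)"
      using slope x_nonzero by (intro multiplesI[of "y / x"]) auto
    then show ?thesis using den 1 assms(2) by auto
  next
    case (2 a)
    have "a \<in> alpha" using 2(1) k_subset_D base_subset_alpha by blast
    then have "num p / den p - a \<in> alpha" using slope by (intro alpha.closed)
    then have "x \<in> multiples alpha (den p)"
      using 2 y_nonzero by (intro multiplesI[of "num p / den p - a"]) (auto simp: field_simps)
    then show ?thesis using den 2(2) assms(2) by auto
  qed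
qed

lemma num_unit_multiple_den:
  assumes "p \<in> points" "q \<in> points" "p \<noteq> q"
  obtains e where "e \<in> units (alpha_at p)" "num q = e * den p"
proof -
  interpret double_transform D "num p" "den p" k using assms(1) by (rule double_transform_point)
  have unit: "a + b * slope \<in> units alpha" if "a \<in> k" "b \<in> k" "a \<noteq> 0" for a b
    using poly_slope_unit[of "[:a, b:]"] that polys_linear[OF subring_k] by (simp add: mult.commute)
  note k_closed = subring_closed[OF subring_k]
  show ?thesis
  proof (cases p)
    case None
    then obtain b where b: "b \<in> k" "q = Some b" using assms by (auto simp: points_def)
    have "num q = (1 + b * slope) * den p"
      unfolding slope_def using x_nonzero by (simp add: b(2) None field_simps)
    then show ?thesis using that unit[of 1 b] b(1) k_closed(2) by simp
  next
    case (Some a)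
    show ?thesis
    proof (cases q)
      case None
      then have "num q = 1 * den p" by (simp add: Some)
      then show ?thesis using that units_one[OF alpha.subring] by blast
    next
      case (Some b)
      have ab: "a \<in> k" "b \<in> k" "b - a \<noteq> 0" using assms Some \<open>p = Some a\<close> by (auto simp: points_def)
      have "num q = ((b - a) + 1 * slope) * den p"
        unfolding slope_def using y_nonzero by (simp add: Some \<open>p = Some a\<close> field_simps)
      then show ?thesis using that unit[of "b - a" 1] ab k_closed by simp
    qed
  qed
qed

lemma gen_in_multiples_den:
  assumes "p \<in> points" "q \<in> points" "p \<noteq> q"
  shows "gen q \<in> multiples (beta_at p) (den p)"
proof -
  interpret double_transform D "num p" "den p" k using assms(1) by (rule double_transform_point)
  obtain e where e: "e \<in> units alpha" "num q = e * den p" using num_unit_multiple_den[OF assms] .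
  have "den q \<in> {x, y}" using assms(2) by (auto elim: pointsE)
  then obtain b where b: "b \<in> alpha" "den q = b * den p"
    using coordinates_in_multiples_den[OF assms(1)] by (blast elim: multiplesE)
  have "gen q = b * b * inverse e * den p"
    using units_nonzero[OF e(1)] v_nonzero
    by (simp add: gen_def e(2) b(2) power2_eq_square field_simps)
  moreover have "b * b * inverse e \<in> alpha"
    using b(1) units_inverse_mem[OF e(1)] by (intro alpha.closed)
  ultimately show ?thesis using alpha_subset_beta by (blast intro: multiplesI)
qed

lemma z_at_eq_gen: "p \<in> points \<Longrightarrow> z_at p = gen p"
  using double_transform.z_def[OF double_transform_point]
    regular_parameters.slope_def[OF regular_parameters_point]
  by (simp add: gen_def power2_eq_square)

lemma gens_in_multiples_z:
  assumes "p \<in> points"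
  shows "{x, y} \<union> G \<subseteq> multiples (beta_at p) (z_at p)"
proof -
  interpret double_transform D "num p" "den p" k using assms by (rule double_transform_point)
  have "multiples alpha (den p) \<subseteq> multiples beta (den p)"
    using alpha_subset_beta by (auto elim!: multiplesE intro: multiplesI)
  then have "{x, y} \<subseteq> multiples beta z"
    using coordinates_in_multiples_den[OF assms] v_multiples_subset_z by blast
  moreover have "gen q \<in> multiples beta z" if "q \<in> points" for q
  proof (cases "q = p")
    case True
    then show ?thesis using z_at_eq_gen[OF assms] multiples_self[OF beta.subring, of z] by simp
  next
    case False
    then show ?thesis using gen_in_multiples_den[OF assms that] v_multiples_subset_z by blast
  qed
  ultimately show ?thesis by (auto simp: G_def)
qed

lemma A_subset_beta:
  assumes "p \<in> points"
  shows "A \<subseteq> beta_at p"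
proof -
  interpret double_transform D "num p" "den p" k using assms by (rule double_transform_point)
  have "G \<subseteq> beta"
    using gens_in_multiples_z[OF assms] ideal_in_subset[OF beta.ideal_v] by blast
  then show ?thesis unfolding A_def using base_subset_beta by (intro adjoin_least beta.subring)
qed

lemma m_subset_multiples_z:
  assumes "p \<in> points"
  shows "m \<subseteq> multiples (beta_at p) (z_at p)"
proof -
  interpret double_transform D "num p" "den p" k using assms by (rule double_transform_point)
  have "ideal_in A (A \<inter> multiples beta z)"
    using subring_A A_subset_beta[OF assms] beta.ideal_v by (rule ideal_in_contraction)
  moreover have "{x, y} \<union> G \<subseteq> A \<inter> multiples beta z"
    using gens_subset_A gens_in_multiples_z[OF assms] by blast
  ultimately show ?thesis unfolding m_def using ideal_gen_least by blast
qed

lemma unit_notin_m: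
  assumes "p \<in> points" "e \<in> units (beta_at p)"
  shows "e \<notin> m"
proof -
  interpret double_transform D "num p" "den p" k using assms(1) by (rule double_transform_point)
  show ?thesis using m_subset_multiples_z[OF assms(1)] beta.unit_notin_v[OF assms(2)] by blast
qed

lemma residue_in_k:
  assumes "s \<in> A"
  obtains c where "c \<in> k" "s - c \<in> m"
proof -
  define U where "U = {c + t | c t. c \<in> k \<and> t \<in> m}"
  have UI: "s \<in> U" if "c \<in> k" "s - c \<in> m" for s c
    unfolding U_def using that by (intro CollectI exI[of _ c] exI[of _ "s - c"]) simp
  have "D \<subseteq> U"
  proof
    fix d assume "d \<in> D"
    then obtain c where c: "c \<in> k" "d - c \<in> max_ideal D"
      using coeff_field unfolding coefficient_field_def by blast
    then have "d - c \<in> m"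
      using gens_subset_m D_subset_A unfolding max_D_eq
      by (auto elim!: span2E intro!: ideal_in_add[OF ideal_m] ideal_in_mult_left[OF ideal_m])
    then show "d \<in> U" using c(1) by (intro UI)
  qed
  moreover have "G \<subseteq> U"
    using gens_subset_m subring_zero[OF subring_k] by (intro subsetI UI[of 0]) auto
  moreover have "subring U"
    unfolding U_def using subring_A subring_k k_subset_A ideal_m by (rule subring_plus_ideal)
  ultimately have "A \<subseteq> U" unfolding A_def by (intro adjoin_least)
  then obtain c t where "c \<in> k" "t \<in> m" "s = c + t" using assms unfolding U_def by blast
  then show ?thesis using that[of c] by simp
qed

lemma units_k_beta:
  assumes "p \<in> points"
  shows "k - {0} \<subseteq> units (beta_at p)"
  using units_mono[of k "beta_at p"] k_subset_A A_subset_beta[OF assms]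
  by (simp add: units_subfield[OF subfield_k])

lemma prime_m: "prime_in A m"
proof (rule prime_inI[OF subring_A ideal_m])
  note None = None_in_points
  have k_Int_m: "c = 0" if "c \<in> k" "c \<in> m" for c
    using that unit_notin_m[OF None] units_k_beta[OF None] by blast
  show "1 \<notin> m" using k_Int_m[of 1] subring_one[OF subring_k] by auto
  fix a b assume ab: "a \<in> A" "b \<in> A" "a * b \<in> m"
  obtain c where c: "c \<in> k" "a - c \<in> m" using residue_in_k[OF ab(1)] .
  obtain d where d: "d \<in> k" "b - d \<in> m" using residue_in_k[OF ab(2)] .
  have "d \<in> A" using d(1) k_subset_A by blast
  then have "a * (b - d) + d * (a - c) \<in> m"
    using ab c d by (intro ideal_in_add[OF ideal_m] ideal_in_mult_left[OF ideal_m])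
  then have "a * b - (a * (b - d) + d * (a - c)) \<in> m"
    using ab(3) by (intro ideal_in_diff[OF subring_A ideal_m])
  then have "c * d \<in> m" by (simp add: algebra_simps)
  then have "c * d = 0" using k_Int_m subring_mult[OF subring_k c(1) d(1)] by blast
  then show "a \<in> m \<or> b \<in> m" using c(2) d(2) by auto
qed

sublocale localization: prime_localization A m
  using subring_A prime_m by unfold_locales

lemma outside_m_unit_beta:
  assumes p: "p \<in> points" and s: "s \<in> A" "s \<notin> m"
  shows "s \<in> units (beta_at p)"
proof -
  interpret double_transform D "num p" "den p" k using p by (rule double_transform_point)
  obtain c where c: "c \<in> k" "s - c \<in> m" using residue_in_k[OF s(1)] .
  then have "c \<in> units beta" using s(2) units_k_beta[OF p] by auto
  have "s - c \<in> span2 beta slope z"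
    using c(2) m_subset_multiples_z[OF p] multiples_least[OF beta.ideal beta.v_in_max] by blast
  then have "s \<notin> span2 beta slope z"
    using \<open>c \<in> units beta\<close> ideal_in_diff[OF beta.subring beta.ideal, of s "s - c"] beta.units_eq
    by auto
  then show ?thesis using s(1) A_subset_beta[OF p] beta.units_eq by blast
qed

lemma C_subset_beta:
  assumes "p \<in> points"
  shows "C \<subseteq> beta_at p"
proof
  interpret double_transform D "num p" "den p" k using assms by (rule double_transform_point)
  fix f assume "f \<in> C"
  then obtain r s where rs: "r \<in> A" "s \<in> A" "s \<notin> m" "f = r / s" unfolding C_def by (rule localizeE)
  then have "r \<in> beta" "inverse s \<in> beta"
    using A_subset_beta[OF assms] units_inverse_mem[OF outside_m_unit_beta[OF assms]] by auto
  then show "f \<in> beta" using rs(4) by (simp add: divide_inverse beta.closed)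
qed

lemma subring_T: "subring T"
proof -
  have "subring (beta_at p)" if "p \<in> points" for p
  proof -
    interpret double_transform D "num p" "den p" k using that by (rule double_transform_point)
    show ?thesis by (rule beta.subring)
  qed
  then show ?thesis unfolding T_def by (rule subring_INT)
qed

lemma A_subset_T: "A \<subseteq> T" and C_subset_T: "C \<subseteq> T"
  using A_subset_beta C_subset_beta by (auto simp: T_def)

section \<open>Initial forms\<close>

abbreviation "max_power \<equiv> span2_power D x y"

definition "form n P = y ^ n * poly P (x / y)"

definition initial_form :: "nat \<Rightarrow> 'a \<Rightarrow> 'a poly \<Rightarrow> bool" where
  "initial_form n h P \<longleftrightarrow> P \<in> polys k \<and> degree P \<le> n \<and> h - form n P \<in> max_power (Suc n)"

lemma initial_form_exists:
  "h \<in> max_power n \<Longrightarrow> \<exists>P. initial_form n h P"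
proof (induction n arbitrary: h)
  case 0
  then obtain c where c: "c \<in> k" "h - c \<in> span2 D x y"
    using coeff_field max_D_eq unfolding coefficient_field_def by auto
  then have "h - c \<in> max_power (Suc 0)" by (auto elim!: span2E simp: mult.commute)
  then have "initial_form 0 h [:c:]"
    using c(1) by (simp add: initial_form_def form_def polys_pCons polys_zero[OF subring_k])
  then show ?case by blast
next
  case (Suc n)
  then obtain a b where ab: "a \<in> max_power n" "b \<in> max_power n" "h = x * a + y * b" by auto
  obtain P where P: "initial_form n a P" using Suc.IH[OF ab(1)] by blast
  obtain Q where Q: "initial_form n b Q" using Suc.IH[OF ab(2)] by blast
  have "h - form (Suc n) (pCons 0 P + Q) = x * (a - form n P) + y * (b - form n Q)"
    using ab(3) y_nonzero by (simp add: form_def algebra_simps)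
  then have "h - form (Suc n) (pCons 0 P + Q) \<in> max_power (Suc (Suc n))"
    unfolding span2_power.simps(2)[of D x y "Suc n"] using P Q unfolding initial_form_def by blast
  moreover have "pCons 0 P + Q \<in> polys k"
    using P Q subring_zero[OF subring_k]
    by (auto simp: initial_form_def polys_pCons intro: polys_add[OF subring_k])
  moreover have "degree (pCons 0 P + Q) \<le> Suc n"
    using P Q degree_pCons_le[of 0 P] by (intro degree_add_le) (auto simp: initial_form_def)
  ultimately show ?case unfolding initial_form_def by blast
qed

lemma form_eq_form_at:
  assumes "p \<in> points" "degree P \<le> n"
  shows "form n P = den p ^ n * poly (form_at p n P) (num p / den p)"
  using assms(1)
proof (cases rule: pointsE)
  case 1
  then show ?thesis
    using poly_form_at_None[OF assms(2) x_nonzero y_nonzero]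
    by (simp add: form_def del: form_at.simps)
next
  case (2 a)
  then show ?thesis
    using poly_form_at_Some[OF y_nonzero] by (simp add: form_def del: form_at.simps)
qed

lemma polys_form_at_point:
  assumes "p \<in> points" "P \<in> polys k"
  shows "form_at p n P \<in> polys k"
  using assms by (intro polys_form_at subring_k) (auto simp: points_def)

lemma poly_x_div_y_nonzero:
  assumes "Q \<in> polys k" "Q \<noteq> 0"
  shows "poly Q (x / y) \<noteq> 0"
proof -
  have "Some 0 \<in> points" using subring_zero[OF subring_k] by (simp add: points_def)
  then interpret double_transform D "num (Some 0)" "den (Some 0)" k by (rule double_transform_point)
  show ?thesis using poly_slope_nonzero[OF assms] unfolding slope_def by simp
qed

lemma form_nonzero: "Q \<in> polys k \<Longrightarrow> Q \<noteq> 0 \<Longrightarrow> form n Q \<noteq> 0"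
  using poly_x_div_y_nonzero y_nonzero by (simp add: form_def)

lemma initial_form_at_point:
  assumes p: "p \<in> points" and h: "initial_form n h P"
  obtains d where "d \<in> alpha_at p"
    "h = den p ^ n * (poly (form_at p n P) (num p / den p) + den p * d)"
proof -
  interpret double_transform D "num p" "den p" k using p by (rule double_transform_point)
  have "max_power (Suc n) \<subseteq> multiples alpha (den p ^ Suc n)"
    by (rule span2_power_subset_multiples[OF alpha.subring base_subset_alpha])
      (use coordinates_in_multiples_den[OF p] in auto)
  then have "h - form n P \<in> multiples alpha (den p ^ Suc n)"
    using h unfolding initial_form_def by blast
  then obtain d where "d \<in> alpha" "h - form n P = d * den p ^ Suc n" by (rule multiplesE)
  moreover from this have "h = den p ^ n * (poly (form_at p n P) (num p / den p) + den p * d)"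
    using form_eq_form_at[OF p, of P n] h by (simp add: initial_form_def algebra_simps)
  ultimately show ?thesis using that by blast
qed

lemma exact_order_exists:
  assumes "q \<in> D" "q \<noteq> 0"
  obtains e where "q \<in> max_power e" "q \<notin> max_power (Suc e)"
proof -
  interpret double_transform D "num None" "den None" k
    using None_in_points by (rule double_transform_point)
  obtain n where "q \<notin> max_power n"
    using span2_power_separated[OF _ _ assms] coordinates_in_multiples_den[OF None_in_points]
    by blast
  then have "\<exists>e<n. (\<forall>i\<le>e. \<not> q \<notin> max_power i) \<and> q \<notin> max_power (Suc e)"
    using assms(1) by (intro ex_least_nat_less) auto
  then show ?thesis using that by blast
qed

context
  fixes Q e
  assumes Q: "Q \<in> polys k" "Q \<noteq> 0" "degree Q \<le> e"
begin

lemma form_quotient_in_A: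
  assumes P: "P \<in> polys k" and "e \<le> j" "bounded_poles k (j - e) P Q"
  shows "form j P / form e Q \<in> A"
proof -
  have "y ^ (j - e) * poly P (x / y) / poly Q (x / y) \<in> A"
  proof (rule partial_fractions[OF subring_A alg_closed k_subset_A poly_x_div_y_nonzero
        _ _ _ _ P Q(1,2) assms(3)])
    show "y \<in> A" "y * (x / y) \<in> A" using x y D_subset_A y_nonzero by auto
    show "y * (x / y)\<^sup>2 \<in> A"
      using gen_in_A[OF None_in_points] y_nonzero by (simp add: gen_def power2_eq_square)
    fix c assume "c \<in> k"
    then have point: "Some (- c) \<in> points"
      using subring_uminus[OF subring_k] by (simp add: points_def)
    have "y / (x / y - c) = gen (Some (- c))"
      using y_nonzero num_nonzero[OF point] by (simp add: gen_def power2_eq_square field_simps)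
    then show "y / (x / y - c) \<in> A" using gen_in_A[OF point] by simp
  qed
  moreover have "y ^ j = y ^ e * y ^ (j - e)" using assms(2) by (simp flip: power_add)
  ultimately show ?thesis using y_nonzero by (simp add: form_def)
qed

lemma initial_form_bounded_poles:
  assumes h: "initial_form j h P" "h / form e Q \<in> T" and "P \<noteq> 0"
  shows "e \<le> j" "bounded_poles k (j - e) P Q"
proof -
  have P: "P \<in> polys k" "degree P \<le> j" using h(1) by (auto simp: initial_form_def)
  have orders: "e \<le> j \<and> e + order 0 (form_at p e Q) \<le> j + order 0 (form_at p j P)"
    if p: "p \<in> points" for p
  proof -
    interpret double_transform D "num p" "den p" k using p by (rule double_transform_point)
    obtain d where d: "d \<in> alpha" "h = den p ^ j * (poly (form_at p j P) slope + den p * d)"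
      using initial_form_at_point[OF p h(1)] unfolding slope_def .
    have "form e Q = den p ^ e * poly (form_at p e Q) slope"
      unfolding slope_def using form_eq_form_at[OF p Q(3)] .
    then have "den p ^ j * (poly (form_at p j P) slope + den p * d)
        / (den p ^ e * poly (form_at p e Q) slope) \<in> beta"
      using h(2) p d(2) by (auto simp: T_def)
    then show ?thesis
      using \<open>P \<noteq> 0\<close> Q(2) initial_form_quotient_orders[OF polys_form_at_point[OF p P(1)] _
          polys_form_at_point[OF p Q(1)] _ d(1)]
      by (simp del: form_at.simps)
  qed
  then show "e \<le> j" using None_in_points by blast
  then show "bounded_poles k (j - e) P Q"
    using orders \<open>P \<noteq> 0\<close> Q P subring_k
    by (intro bounded_poles_if_order_form_at) (auto simp: points_def)
qed

lemma high_order_quotient_in_A: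
  "h \<in> max_power n \<Longrightarrow> n + i + l = 2 * e \<Longrightarrow> h * x ^ i * y ^ l / form e Q \<in> A"
proof (induction n arbitrary: h i l)
  case 0
  have "order c Q \<le> e" for c using order_degree[OF Q(2), of c] Q(3) by simp
  then have "bounded_poles k (2 * e - e) (monom 1 i) Q"
    using 0(2) degree_monom_le[of "1::'a" i]
    by (auto simp: bounded_poles_def intro: le_trans trans_le_add2)
  then have "form (2 * e) (monom 1 i) / form e Q \<in> A"
    by (intro form_quotient_in_A polys_monom subring_k subring_one) auto
  moreover have "form (2 * e) (monom 1 i) = x ^ i * y ^ l"
    using 0(2) y_nonzero by (simp add: form_def poly_monom power_divide power_add flip: 0(2))
  ultimately have "x ^ i * y ^ l / form e Q \<in> A" by simp
  moreover have "h \<in> A" using 0(1) D_subset_A by auto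
  ultimately have "h * (x ^ i * y ^ l / form e Q) \<in> A" by (intro subring_mult[OF subring_A])
  then show ?case by (simp add: ac_simps)
next
  case (Suc n)
  then obtain a b where ab: "a \<in> max_power n" "b \<in> max_power n" "h = x * a + y * b" by auto
  have "a * x ^ Suc i * y ^ l / form e Q \<in> A" "b * x ^ i * y ^ Suc l / form e Q \<in> A"
    using Suc.prems(2) by (intro Suc.IH ab(1,2); simp)+
  then have "a * x ^ Suc i * y ^ l / form e Q + b * x ^ i * y ^ Suc l / form e Q \<in> A"
    by (rule subring_add[OF subring_A])
  then show ?case unfolding ab(3) by (simp add: algebra_simps add_divide_distrib)
qed

lemma quotient_in_A_of_order:
  assumes "n \<le> 2 * e"
  shows "h \<in> max_power n \<Longrightarrow> h / form e Q \<in> T \<Longrightarrow> h / form e Q \<in> A"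
  using assms
proof (induction n arbitrary: h rule: inc_induct)
  case base
  then show ?case using high_order_quotient_in_A[of h "2 * e" 0 0] by simp
next
  case (step n)
  obtain P where P: "initial_form n h P" using initial_form_exists[OF step.prems(1)] by blast
  have form_A: "form n P / form e Q \<in> A"
  proof (cases "P = 0")
    case False
    then show ?thesis
      using initial_form_bounded_poles[OF P step.prems(2)] P
      by (intro form_quotient_in_A) (auto simp: initial_form_def)
  qed (simp add: form_def subring_zero[OF subring_A])
  have "h / form e Q - form n P / form e Q \<in> T"
    using step.prems(2) form_A A_subset_T by (intro subring_diff[OF subring_T]) auto
  then have "(h - form n P) / form e Q \<in> A"
    using P by (intro step.IH) (auto simp: initial_form_def diff_divide_distrib)
  then have "(h - form n P) / form e Q + form n P / form e Q \<in> A"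
    using form_A by (rule subring_add[OF subring_A])
  then show ?case by (simp add: diff_divide_distrib)
qed

lemma quotient_in_A: "h \<in> D \<Longrightarrow> h / form e Q \<in> T \<Longrightarrow> h / form e Q \<in> A"
  using quotient_in_A_of_order[of 0] by simp

end

section \<open>The intersection is a non-Noetherian localization\<close>

lemma reduced_denominator_over_form_unit:
  assumes f: "f \<in> T" and q: "q \<in> D" "{s\<in>D. s * f \<in> D} \<subseteq> multiples D q"
    and Q: "initial_form e q Q" "Q \<noteq> 0" and p: "p \<in> points"
  shows "q / form e Q \<in> units (beta_at p)"
proof -
  interpret double_transform D "num p" "den p" k using p by (rule double_transform_point)
  have Q': "Q \<in> polys k" "degree Q \<le> e" using Q(1) by (auto simp: initial_form_def)
  obtain d where d: "d \<in> alpha" "q = den p ^ e * (poly (form_at p e Q) slope + den p * d)"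
    using initial_form_at_point[OF p Q(1)] unfolding slope_def .
  have "f \<in> beta" using f p by (auto simp: T_def)
  then have "q \<in> monomials beta slope z" using q by (rule reduced_denominator_monomial)
  then have "q / (den p ^ e * poly (form_at p e Q) slope) \<in> units beta"
    using initial_form_quotient_unit[OF polys_form_at_point[OF p Q'(1)] _ d(1)] Q(2)
    unfolding d(2) by simp
  then show ?thesis using form_eq_form_at[OF p Q'(2)] by (simp add: slope_def)
qed

lemma T_subset_C: "T \<subseteq> C"
proof
  fix f assume f: "f \<in> T"
  obtain a b where "a \<in> D" "b \<in> D" "b \<noteq> 0" "f = a / b"
    using quotient_field unfolding quotient_field_is_univ_def by blast
  then obtain q where q: "q \<in> D" "q \<noteq> 0" "q * f \<in> D" "{s\<in>D. s * f \<in> D} \<subseteq> multiples D q"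
    using regular_parameters.reduced_denominator[OF regular_parameters_point, of None b f]
      None_in_points
    by auto
  obtain e where e: "q \<in> max_power e" "q \<notin> max_power (Suc e)"
    using exact_order_exists[OF q(1,2)] .
  obtain Q where Q: "initial_form e q Q" using initial_form_exists[OF e(1)] by blast
  have Q': "Q \<in> polys k" "Q \<noteq> 0" "degree Q \<le> e"
    using Q e(2) by (auto simp: initial_form_def form_def)
  have unit: "q / form e Q \<in> units (beta_at p)" if "p \<in> points" for p
    using reduced_denominator_over_form_unit[OF f q(1,4) Q Q'(2) that] .
  have qT: "q / form e Q \<in> T" using units_mem[OF unit] by (auto simp: T_def)
  then have "q / form e Q \<in> A" using quotient_in_A[OF Q' q(1)] by blast
  moreover have "q / form e Q * f \<in> T" using qT f by (rule subring_mult[OF subring_T])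
  then have "q * f / form e Q \<in> A" using quotient_in_A[OF Q' q(3)] by simp
  moreover have "q / form e Q \<notin> m" using unit_notin_m[OF None_in_points unit[OF None_in_points]] .
  moreover have "f = (q * f / form e Q) / (q / form e Q)"
    using form_nonzero[OF Q'(1,2)] q(2) by simp
  ultimately show "f \<in> C" unfolding C_def by (intro localizeI)
qed

lemma C_eq_T: "C = T"
  using C_subset_T T_subset_C by blast

lemma not_noetherian_C: "\<not> noetherian C"
proof (rule not_noetherian_of_independent_ideals[OF _ infinite_points])
  show subring_C: "subring C" unfolding C_def by (rule localization.subring_localize)
  fix p assume p: "p \<in> points"
  interpret double_transform D "num p" "den p" k using p by (rule double_transform_point)
  have "den p \<in> beta" using v base_subset_beta by blast
  then show "ideal_in C (C \<inter> multiples (beta_at p) (den p))"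
    using ideal_in_contraction[OF subring_C C_subset_beta[OF p]] ideal_in_multiples[OF beta.subring]
    by blast
  have "gen q \<in> C" if "q \<in> points" for q
    using gen_in_A[OF that] localization.superset by (auto simp: C_def)
  then show "gen p \<in> C \<and> gen p \<notin> C \<inter> multiples (beta_at p) (den p)"
    "\<And>q. q \<in> points \<Longrightarrow> q \<noteq> p \<Longrightarrow> gen q \<in> C \<inter> multiples (beta_at p) (den p)"
    using p z_notin_v z_at_eq_gen[OF p] gen_in_multiples_den[OF p] by auto
qed

lemma beta_in_Qset:
  assumes "p \<in> points"
  shows "beta_at p \<in> Qset D"
proof -
  interpret double_transform D "num p" "den p" k using assms by (rule double_transform_point)
  show ?thesis using base_subset_beta beta.regular_local2 by (simp add: Qset_def)
qed

lemma beta_at_eq: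
  assumes "p \<in> points"
  shows "beta_at p = localize (adjoin (quadratic D (num p) (den p)) {gen p})
    (ideal_gen (adjoin (quadratic D (num p) (den p)) {gen p}) {num p / den p, gen p})"
proof -
  interpret double_transform D "num p" "den p" k using assms by (rule double_transform_point)
  have "den p / slope = gen p" using z_at_eq_gen[OF assms] by (simp add: z_def)
  then show ?thesis unfolding beta_def alpha_def quadratic_def[of _ "den p"]
    by (simp add: slope_def)
qed

end

theorem theorem6p17:
  fixes D k :: "'a::field set" and x y :: 'a
  assumes "regular_local2 D"
    and "quotient_field_is_univ D"
    and "x \<in> D" and "y \<in> D"
    and "max_ideal D = ideal_gen D {x, y}"
    and "coefficient_field D k"
    and "alg_closed_subfield k"
  defines "G \<equiv> {y\<^sup>2 / (x + a * y) | a. a \<in> k} \<union> {x\<^sup>2 / y}"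
  defines "A \<equiv> adjoin D G"
  defines "m \<equiv> ideal_gen A ({x, y} \<union> G)"
  defines "C \<equiv> localize A m"
  defines "\<alpha> \<equiv> (\<lambda>a. localize (adjoin D {(x + a * y) / y})
                 (ideal_gen (adjoin D {(x + a * y) / y}) {y, (x + a * y) / y}))"
  defines "\<beta> \<equiv> (\<lambda>a. localize (adjoin (\<alpha> a) {y\<^sup>2 / (x + a * y)})
                 (ideal_gen (adjoin (\<alpha> a) {y\<^sup>2 / (x + a * y)})
                    {(x + a * y) / y, y\<^sup>2 / (x + a * y)}))"
  defines "\<alpha>' \<equiv> localize (adjoin D {y / x}) (ideal_gen (adjoin D {y / x}) {x, y / x})"
  defines "\<beta>' \<equiv> localize (adjoin \<alpha>' {x\<^sup>2 / y})
                 (ideal_gen (adjoin \<alpha>' {x\<^sup>2 / y}) {y / x, x\<^sup>2 / y})"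
  shows "C = (\<Inter>a\<in>k. \<beta> a) \<inter> \<beta>'
         \<and> subring C \<and> local_ring C \<and> \<not> noetherian C
         \<and> (\<exists>S. S \<subseteq> Qset D \<and> S \<noteq> {} \<and> C = \<Inter> S)"
proof -
  interpret R: regular_over_alg_closed D k x y using assms(1-7) by unfold_locales
  have "G = R.G"
    by (simp add: G_def R.G_def R.points_def R.gen_def Setcompr_eq_image image_image)
  then have C: "C = R.C" by (simp add: C_def m_def A_def R.C_def R.m_def R.A_def)
  have "\<beta> a = R.beta_at (Some a)" if "a \<in> k" for a
    using R.beta_at_eq[of "Some a"] that
    by (simp add: R.points_def R.gen_def quadratic_def \<beta>_def \<alpha>_def)
  moreover have "\<beta>' = R.beta_at None"
    using R.beta_at_eq[OF R.None_in_points] by (simp add: R.gen_def quadratic_def \<beta>'_def \<alpha>'_def)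
  ultimately have "R.T = (\<Inter>a\<in>k. \<beta> a) \<inter> \<beta>'" by (auto simp: R.T_def R.points_def)
  moreover have "R.C = \<Inter> (R.beta_at ` R.points)" using R.C_eq_T by (simp add: R.T_def)
  moreover have "R.beta_at ` R.points \<subseteq> Qset D" "R.beta_at ` R.points \<noteq> {}"
    using R.beta_in_Qset R.None_in_points by auto
  moreover have "subring R.C" "local_ring R.C"
    unfolding R.C_def
    using R.localization.subring_localize
      local_subring.local_ring[OF R.localization.local_subring_localize] .
  ultimately show ?thesis using C R.C_eq_T R.not_noetherian_C by metis
qed

end
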